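(* Let $G$ be a finite graph with no isolated vertices and with maximum degree at most two. Then $\sigma(G)=\delta(G)$, except for the two graphs $G=C_4$ and $G=C_4+P_2$, for which $\sigma(G)=\delta(G)+1$.
   Context: All graphs are finite, simple and undirected. A graph $H=(V,E)$ is a sum graph if there is an injective map $\lambda:V\to\mathbb{N}=\{1,2,\dots\}$ (a sum labelling) such that $E=\{xy : \exists z\in V,\ \lambda(z)=\lambda(x)+\lambda(y)\}$. For a graph $G$ without isolated vertices, the sum number $\sigma(G)$ is the minimum $k\ge 0$ such that $G+N_k$ is a sum graph, where $N_k$ is the edgeless graph on $k$ vertices and $+$ denotes disjoint union. $\delta(G)$ is the minimum degree of $G$; $C_n$ is the cycle on $n$ vertices and $P_k$ is the path on $k$ vertices. *)

theory Defs
  imports Main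
begin

text \<open>Undirected graphs; an edge is the set of its two endpoints.\<close>

record 'a ugraph =
  verts :: "'a set"
  edges :: "'a set set"

definition simple_graph :: "'a ugraph \<Rightarrow> bool" where
  "simple_graph G \<longleftrightarrow> finite (verts G) \<and>
     edges G \<subseteq> {{x, y} | x y. x \<in> verts G \<and> y \<in> verts G \<and> x \<noteq> y}"

definition degree :: "'a ugraph \<Rightarrow> 'a \<Rightarrow> nat" where
  "degree G v = card {e \<in> edges G. v \<in> e}"

definition isolated :: "'a ugraph \<Rightarrow> 'a \<Rightarrow> bool" where
  "isolated G v \<longleftrightarrow> v \<in> verts G \<and> (\<forall>e \<in> edges G. v \<notin> e)"

text \<open>The two extremal degrees are meaningful only for finite graphs with at least one vertex.\<close>

definition min_degree :: "'a ugraph \<Rightarrow> nat" where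
  "min_degree G = Min (degree G ` verts G)"

definition max_degree :: "'a ugraph \<Rightarrow> nat" where
  "max_degree G = Max (degree G ` verts G)"

definition graph_iso :: "'a ugraph \<Rightarrow> 'b ugraph \<Rightarrow> bool" where
  "graph_iso G H \<longleftrightarrow>
     (\<exists>f. bij_betw f (verts G) (verts H) \<and> edges H = (\<lambda>e. f ` e) ` edges G)"

definition disjoint_union :: "'a ugraph \<Rightarrow> 'b ugraph \<Rightarrow> ('a + 'b) ugraph" where
  "disjoint_union G H =
     \<lparr>verts = verts G <+> verts H,
      edges = (\<lambda>e. Inl ` e) ` edges G \<union> (\<lambda>e. Inr ` e) ` edges H\<rparr>"

definition edgeless_graph :: "nat \<Rightarrow> nat ugraph" where
  "edgeless_graph k = \<lparr>verts = {..<k}, edges = {}\<rparr>"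

text \<open>A cycle only for \<open>n \<ge> 3\<close>.\<close>

definition cycle_graph :: "nat \<Rightarrow> nat ugraph" where
  "cycle_graph n = \<lparr>verts = {..<n}, edges = {{i, (i + 1) mod n} | i. i < n}\<rparr>"

text \<open>The index counts vertices, not edges.\<close>

definition path_graph :: "nat \<Rightarrow> nat ugraph" where
  "path_graph k = \<lparr>verts = {..<k}, edges = {{i, i + 1} | i. i + 1 < k}\<rparr>"

text \<open>
  Labels are positive. The endpoints are required to be distinct because the graphs are
  simple: a label that is twice another label induces no loop. The vertex \<open>z\<close> carrying
  the sum is automatically different from \<open>x\<close> and \<open>y\<close>.
\<close>

definition sum_labelling :: "'a ugraph \<Rightarrow> ('a \<Rightarrow> nat) \<Rightarrow> bool" where
  "sum_labelling H l \<longleftrightarrow> inj_on l (verts H) \<and> (\<forall>v \<in> verts H. l v \<ge> 1) \<and>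
     edges H = {{x, y} | x y. x \<in> verts H \<and> y \<in> verts H \<and> x \<noteq> y \<and>
                              (\<exists>z \<in> verts H. l z = l x + l y)}"

definition sum_graph :: "'a ugraph \<Rightarrow> bool" where
  "sum_graph H \<longleftrightarrow> (\<exists>l. sum_labelling H l)"

definition sum_number :: "'a ugraph \<Rightarrow> nat" where
  "sum_number G = (LEAST k. sum_graph (disjoint_union G (edgeless_graph k)))"

end

theory Submission
  imports Defs "HOL-Library.Multiset"
begin

text \<open>
  \<^emph>\<open>Lower bound.\<close> All edges at the vertex of \<open>G\<close> with the largest label have their sums on the added
  isolated vertices, so \<open>\<sigma>(G) \<ge> \<delta>(G)\<close>; the two exceptional graphs need a short case analysis
  around the largest label of the 4-cycle.

  \<^emph>\<open>Upper bound.\<close> \<open>G\<close> is a disjoint union of paths and cycles, and the components are labelled one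
  after the other. If the two largest labels \<open>z\<^sub>1 < z\<^sub>2\<close> are the isolated ones, the Fibonacci sequence
  \<open>v\<^sub>0 = z\<^sub>1, v\<^sub>1 = z\<^sub>2, v\<^sub>2 = z\<^sub>1 + z\<^sub>2, \<dots>\<close> turns them into vertices of a new component: the labels
  \<open>v\<^sub>0, \<dots>, v\<^sub>n\<^sub>-\<^sub>1\<close> form a path whose only unused sum is \<open>v\<^sub>n\<close>, and adding the label \<open>v\<^sub>n\<^sub>-\<^sub>1 + v\<^sub>0\<close> closes the path
  to a cycle with the two unused sums \<open>v\<^sub>n\<^sub>-\<^sub>1 + v\<^sub>0\<close> and \<open>v\<^sub>n\<close>. Closing fails for \<open>n = 4\<close>, because then
  \<open>v\<^sub>1 + (v\<^sub>3 + v\<^sub>0) = v\<^sub>4\<close>.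

  The 4-cycles are added last and cost no isolated vertices at all: if some labels \<open>h, h + d, h + 2d\<close>
  are in progression while \<open>d\<close> is not a label, multiply all labels by 4 and add the 4-cycle
  \<open>1, 4h - 1, 4d + 1, 4(h + d) - 1\<close>, whose edge sums are \<open>4h, 4(h + d), 4(h + 2d), 4(h + d)\<close>. Such a progression
  is available after the first component, unless that component is \<open>P\<^sub>2\<close> or \<open>C\<^sub>4\<close>; the graphs with
  only such components start from explicit labellings of \<open>2P\<^sub>2\<close> or \<open>2C\<^sub>4\<close>.
\<close>

section \<open>Decompositions into paths and cycles\<close>

text \<open>A component is a list of consecutive vertices with a flag that is true for cycles.\<close>

fun path_edges :: "'a list \<Rightarrow> 'a set set" where
  "path_edges (x # y # zs) = insert {x, y} (path_edges (y # zs))"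
| "path_edges _ = {}"

fun comp_edges :: "bool \<times> 'a list \<Rightarrow> 'a set set" where
  "comp_edges (b, vs) = path_edges vs \<union> (if b then {{last vs, hd vs}} else {})"

fun valid_comp :: "bool \<times> 'a list \<Rightarrow> bool" where
  "valid_comp (b, vs) \<longleftrightarrow> (if b then 3 else 2) \<le> length vs"

definition shape :: "bool \<times> 'a list \<Rightarrow> bool \<times> nat" where
  "shape c = (fst c, length (snd c))"

text \<open>Distinctness of the concatenated list says at once that no component repeats a vertex
  and that the components are pairwise disjoint.\<close>

definition decomp :: "'a set \<Rightarrow> 'a set set \<Rightarrow> (bool \<times> 'a list) list \<Rightarrow> bool" where
  "decomp V E cs \<longleftrightarrow> (\<forall>c \<in> set cs. valid_comp c) \<and> distinct (concat (map snd cs)) \<and>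
     V = set (concat (map snd cs)) \<and> E = \<Union> (comp_edges ` set cs)"

lemma path_edges_snoc:
  "xs \<noteq> [] \<Longrightarrow> path_edges (xs @ [b]) = insert {last xs, b} (path_edges xs)"
  by (induction xs rule: path_edges.induct) auto

lemma path_edges_nth: "path_edges xs = {{xs ! i, xs ! Suc i} | i. Suc i < length xs}"
proof (induction xs rule: path_edges.induct)
  case (1 x y zs)
  have "{{(x # y # zs) ! i, (x # y # zs) ! Suc i} | i. Suc i < length (x # y # zs)}
      = insert {x, y} {{(y # zs) ! i, (y # zs) ! Suc i} | i. Suc i < length (y # zs)}" (is "?L = ?R")
  proof
    show "?L \<subseteq> ?R"
    proof
      fix e assume "e \<in> ?L"
      then obtain i where "Suc i < length (x # y # zs)"
        "e = {(x # y # zs) ! i, (x # y # zs) ! Suc i}" by blast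
      then show "e \<in> ?R" by (cases i) auto
    qed
    show "?R \<subseteq> ?L"
    proof
      fix e assume "e \<in> ?R"
      then consider "e = {x, y}"
        | i where "Suc i < length (y # zs)" "e = {(y # zs) ! i, (y # zs) ! Suc i}" by blast
      then show "e \<in> ?L"
      proof cases
        case 1
        then show ?thesis by (intro CollectI exI[of _ 0]) auto
      next
        case 2
        then show ?thesis by (intro CollectI exI[of _ "Suc i"]) auto
      qed
    qed
  qed
  with 1 show ?case by simp
qed auto

lemma path_edges_map: "path_edges (map f xs) = (`) f ` path_edges xs"
  by (induction xs rule: path_edges.induct) auto

lemma path_edges_subset: "e \<in> path_edges xs \<Longrightarrow> e \<subseteq> set xs"
  by (induction xs rule: path_edges.induct) auto

lemma comp_edges_subset: "valid_comp c \<Longrightarrow> e \<in> comp_edges c \<Longrightarrow> e \<subseteq> set (snd c)"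
  by (cases c) (auto dest: path_edges_subset split: if_splits intro!: last_in_set hd_in_set)

lemma comp_edges_map:
  "valid_comp c \<Longrightarrow> comp_edges (map_prod id (map f) c) = (`) f ` comp_edges c"
proof (cases c)
  case (Pair b vs)
  assume "valid_comp c"
  then have "vs \<noteq> []" using Pair by (auto split: if_splits)
  then show ?thesis
    by (simp add: Pair path_edges_map image_Un last_map hd_map)
qed

lemma valid_comp_map [simp]: "valid_comp (map_prod id (map f) c) = valid_comp c"
  by (cases c) auto

lemma shape_map [simp]: "shape (map_prod id (map f) c) = shape c"
  by (cases c) (auto simp: shape_def)

lemma decomp_edge_subset: "decomp V E cs \<Longrightarrow> e \<in> E \<Longrightarrow> e \<subseteq> V"
proof -
  assume "decomp V E cs" "e \<in> E"
  then obtain c where "c \<in> set cs" "e \<in> comp_edges c" "valid_comp c"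
    and V: "V = set (concat (map snd cs))"
    unfolding decomp_def by auto
  then have "e \<subseteq> set (snd c)" "set (snd c) \<subseteq> V" using comp_edges_subset[of c e] by auto
  then show "e \<subseteq> V" by blast
qed

lemma concat_map_snd_map:
  "concat (map snd (map (map_prod id (map f)) cs)) = map f (concat (map snd cs))"
  by (induction cs) auto

lemma decomp_map:
  assumes "decomp V E cs" "inj_on f V"
  shows "decomp (f ` V) ((`) f ` E) (map (map_prod id (map f)) cs)"
proof -
  let ?cs = "map (map_prod id (map f)) cs"
  have V: "V = set (concat (map snd cs))" and E: "E = \<Union> (comp_edges ` set cs)"
    and val: "\<forall>c \<in> set cs. valid_comp c" and d: "distinct (concat (map snd cs))"
    using assms(1) unfolding decomp_def by auto
  have "\<Union> (comp_edges ` set ?cs) = (\<Union>c \<in> set cs. comp_edges (map_prod id (map f) c))"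
    by simp
  also have "\<dots> = (\<Union>c \<in> set cs. (`) f ` comp_edges c)"
    using val by (intro SUP_cong refl comp_edges_map) auto
  also have "\<dots> = (`) f ` E" unfolding E by (rule image_UN [symmetric])
  finally have 1: "\<Union> (comp_edges ` set ?cs) = (`) f ` E" .
  have 2: "distinct (concat (map snd ?cs))"
    unfolding concat_map_snd_map using d assms(2) V by (simp add: distinct_map del: set_concat)
  have 3: "f ` V = set (concat (map snd ?cs))"
    unfolding concat_map_snd_map V by (simp del: set_concat map_concat)
  show ?thesis unfolding decomp_def using 1 2 3 val by (auto simp del: set_concat)
qed

lemma mset_concat_map: "mset (concat (map g xs)) = \<Sum>\<^sub># (image_mset (mset \<circ> g) (mset xs))"
  by (induction xs) auto

lemma decomp_mset:
  assumes "decomp V E cs" "mset cs = mset cs'"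
  shows "decomp V E cs'"
proof -
  have s: "set cs = set cs'" using assms(2) by (rule mset_eq_setD)
  have "mset (concat (map snd cs)) = mset (concat (map snd cs'))"
    using assms(2) by (simp add: mset_concat_map)
  then have "distinct (concat (map snd cs)) = distinct (concat (map snd cs'))"
    by (rule mset_eq_imp_distinct_iff)
  then show ?thesis using assms(1) s unfolding decomp_def by auto
qed

text \<open>Serves to list components in a prescribed order of shapes: a preimage of the head of
  \<open>ys\<close> is removed from \<open>xs\<close>, and induction rearranges the rest.\<close>

lemma mset_map_eqE:
  assumes "mset (map g xs) = mset ys"
  obtains xs' where "mset xs' = mset xs" "map g xs' = ys"
  using assms
proof (induction ys arbitrary: xs thesis)
  case Nil
  then show ?case by simp
next
  case (Cons y ys)
  have "y \<in># mset (map g xs)" using Cons.prems(2) by simp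
  then obtain x where x: "x \<in> set xs" "y = g x" by auto
  have "mset (map g (remove1 x xs)) = mset ys"
    using Cons.prems(2) x by (simp add: image_mset_Diff)
  then obtain xs' where "mset xs' = mset (remove1 x xs)" "map g xs' = ys"
    using Cons.IH by blast
  then show ?case using Cons.prems(1)[of "x # xs'"] x by simp
qed

text \<open>Shapes determine the graph up to isomorphism: once \<open>cs\<close> is reordered so
  that the shapes agree, the concatenated vertex lists have equal length, and matching them position
  by position carries each component to its counterpart.\<close>

lemma decomp_iso:
  assumes "decomp V E cs" "decomp V' E' cs'" "mset (map shape cs) = mset (map shape cs')"
  obtains f where "bij_betw f V V'" "E' = (`) f ` E"
proof -
  obtain ds where ds: "mset ds = mset cs" "map shape ds = map shape cs'"
    using mset_map_eqE[OF assms(3)] .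
  have dd: "decomp V E ds" using decomp_mset[OF assms(1)] ds(1) by simp
  have len: "length ds = length cs'" using ds(2) by (metis length_map)
  have sh: "shape (ds ! i) = shape (cs' ! i)" if "i < length ds" for i
    using ds(2) that len by (metis nth_map)
  define P where "P = concat (map snd ds)"
  define Q where "Q = concat (map snd cs')"
  have dist: "distinct P" "distinct Q" and V: "V = set P" "V' = set Q"
    using dd assms(2) unfolding decomp_def P_def Q_def by auto
  have ml: "map (length \<circ> snd) ds = map (length \<circ> snd) cs'"
    using sh len by (intro nth_equalityI) (auto simp: shape_def)
  have lPQ: "length P = length Q"
    using ml unfolding P_def Q_def length_concat by simp
  define f where "f = (\<lambda>x. the (map_of (zip P Q) x))"
  have fPQ: "map f P = Q"
    by (rule nth_equalityI) (auto simp: lPQ f_def map_of_zip_nth dist)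
  have inj: "inj_on f V" using fPQ dist V by (metis distinct_map)
  have fV: "f ` V = V'" using fPQ V by (metis set_map)
  let ?ds = "map (map_prod id (map f)) ds"
  have c: "concat (map snd ?ds) = concat (map snd cs')"
    unfolding concat_map_snd_map using fPQ by (simp add: P_def Q_def)
  have "map snd ?ds = map snd cs'"
  proof -
    have "length (snd (ds ! i)) = length (snd (cs' ! i))" if "i < length ds" for i
      using sh[OF that] by (auto simp: shape_def)
    then have "\<forall>(x, y) \<in> set (zip (map snd ?ds) (map snd cs')). length x = length y"
      using len by (auto simp: set_zip)
    \<comment> \<open>Equal concatenations with blocks of equal lengths have equal blocks.\<close>
    from concat_eq_concat_iff[OF this] show ?thesis using c len by simp
  qed
  moreover have "map fst ?ds = map fst cs'"
    using sh len by (intro nth_equalityI) (auto simp: shape_def)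
  ultimately have eq: "?ds = cs'" by (metis zip_map_fst_snd)
  have "decomp (f ` V) ((`) f ` E) ?ds" using decomp_map[OF dd inj] .
  then have "E' = (`) f ` E" using assms(2) eq unfolding decomp_def by auto
  then show thesis using that inj fV by (auto simp: bij_betw_def)
qed

lemma decomp_Cons:
  assumes "decomp V E cs" "valid_comp (b, ws)" "distinct ws" "set ws \<inter> V = {}"
  shows "decomp (V \<union> set ws) (E \<union> comp_edges (b, ws)) ((b, ws) # cs)"
  using assms unfolding decomp_def by (auto simp del: valid_comp.simps comp_edges.simps)

lemma decomp_Nil: "decomp {} {} []"
  by (simp add: decomp_def)

section \<open>Sum graphs on sets of labels\<close>

text \<open>As labels are injective, a vertex can be identified with its label, so that a labelled
  graph is just a set of numbers.\<close>

definition sum_edges :: "nat set \<Rightarrow> nat set set" where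
  "sum_edges S = {{x, y} | x y. x \<in> S \<and> y \<in> S \<and> x \<noteq> y \<and> x + y \<in> S}"

text \<open>An enumeration that the simplifier can evaluate on explicit label sets; each pair is
  listed with its smaller label first.\<close>

lemma sum_edges_set:
  "sum_edges (set xs) = set [{x, y}. x \<leftarrow> xs, y \<leftarrow> xs, x < y \<and> x + y \<in> set xs]" (is "_ = ?R")
proof
  show "sum_edges (set xs) \<subseteq> ?R"
  proof
    fix e assume "e \<in> sum_edges (set xs)"
    then obtain x y where xy: "x \<in> set xs" "y \<in> set xs" "x \<noteq> y" "x + y \<in> set xs" "e = {x, y}"
      unfolding sum_edges_def by blast
    consider "x < y" | "y < x" using xy(3) by linarith
    then show "e \<in> ?R"
    proof cases
      case 1
      then show ?thesis using xy by auto
    next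
      case 2
      moreover have "y + x \<in> set xs" "e = {y, x}" using xy by (auto simp: add.commute)
      ultimately show ?thesis using xy by auto
    qed
  qed
  show "?R \<subseteq> sum_edges (set xs)"
    unfolding sum_edges_def by auto
qed

text \<open>Among the sums of two distinct labels, \<open>p + q\<close> is the largest and comes
  only from the two largest labels. As a summand it would exceed every label, because 0 is
  absent.\<close>

lemma sum_edges_insert_top:
  assumes "p \<in> S" "q \<in> S" "p < q" "\<forall>s \<in> S. s = p \<or> s = q \<or> s < p" "0 \<notin> S"
  shows "sum_edges (insert (p + q) S) = insert {p, q} (sum_edges S)"
proof
  have le: "s \<le> p \<or> s = q" if "s \<in> S" for s
    using bspec[OF assms(4) that] by auto
  have leq: "s \<le> q" if "s \<in> S" for s using le[OF that] assms(3) by auto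
  have p0: "p > 0" using assms(1,5) by (cases p) auto
  show "sum_edges (insert (p + q) S) \<subseteq> insert {p, q} (sum_edges S)"
  proof
    fix e assume "e \<in> sum_edges (insert (p + q) S)"
    then obtain x y where xy: "x \<in> insert (p + q) S" "y \<in> insert (p + q) S" "x \<noteq> y"
      "x + y \<in> insert (p + q) S" "e = {x, y}"
      unfolding sum_edges_def by blast
    have pos: "x > 0" "y > 0" using xy(1,2) assms(5) p0 by (auto intro: gr0I)
    have le2: "x + y \<le> p + q" using xy(4) leq by fastforce
    have xS: "x \<in> S" "y \<in> S" using xy(1,2) le2 pos by auto
    show "e \<in> insert {p, q} (sum_edges S)"
    proof (cases "x + y \<in> S")
      case True
      then show ?thesis using xS xy unfolding sum_edges_def by blast
    next
      case False
      then have s: "x + y = p + q" using xy(4) by auto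
      have "x = p \<and> y = q \<or> x = q \<and> y = p"
        using le[OF xS(1)] le[OF xS(2)] s xy(3) assms(3) by auto
      then show ?thesis using xy(5) by auto
    qed
  qed
  show "insert {p, q} (sum_edges S) \<subseteq> sum_edges (insert (p + q) S)"
    using assms unfolding sum_edges_def by auto
qed

text \<open>
  \<open>M\<close> collects the shapes of the components, \<open>S\<close> all labels, and \<open>Z\<close> the labels of the added
  isolated vertices.
\<close>

definition sum_rep :: "(bool \<times> nat) multiset \<Rightarrow> nat set \<Rightarrow> nat set \<Rightarrow> bool" where
  "sum_rep M S Z \<longleftrightarrow> finite S \<and> Z \<subseteq> S \<and> 0 \<notin> S \<and>
     (\<exists>cs. mset (map shape cs) = M \<and> decomp (S - Z) (sum_edges S) cs)"

text \<open>Otherwise \<open>z\<close> would lie on an edge, but the edges of the decomposition stay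
  inside \<open>S - Z\<close>.\<close>

lemma sum_rep_isolated:
  assumes "sum_rep M S Z" "z \<in> Z" "s \<in> S" "s \<noteq> z"
  shows "z + s \<notin> S"
proof
  assume "z + s \<in> S"
  then have "{z, s} \<in> sum_edges S" using assms unfolding sum_rep_def sum_edges_def by blast
  then show False using assms decomp_edge_subset unfolding sum_rep_def by blast
qed

lemma sum_rep_add:
  assumes "sum_rep M S Z" "valid_comp (b, ws)" "distinct ws" "set ws \<inter> (S - Z) = {}"
    and "finite S'" "Z' \<subseteq> S'" "0 \<notin> S'" "S' - Z' = (S - Z) \<union> set ws"
    and "sum_edges S' = sum_edges S \<union> comp_edges (b, ws)"
  shows "sum_rep (add_mset (b, length ws) M) S' Z'"
proof -
  obtain cs where "mset (map shape cs) = M" "decomp (S - Z) (sum_edges S) cs"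
    using assms(1) unfolding sum_rep_def by auto
  then have "mset (map shape ((b, ws) # cs)) = add_mset (b, length ws) M"
    "decomp (S' - Z') (sum_edges S') ((b, ws) # cs)"
    using decomp_Cons[of "S - Z" "sum_edges S" cs b ws] assms
    by (auto simp: shape_def simp del: valid_comp.simps comp_edges.simps)
  then show ?thesis using assms unfolding sum_rep_def by blast
qed

definition top_one :: "(bool \<times> nat) multiset \<Rightarrow> nat set \<Rightarrow> nat \<Rightarrow> bool" where
  "top_one M S z \<longleftrightarrow> sum_rep M S {z} \<and> (\<forall>s \<in> S. s = z \<or> s < z)"

text \<open>The clause \<open>z2 \<noteq> 2 * z1\<close> serves the addition of a triangle, where
  \<open>sum_rep_isolated\<close> is applied to \<open>z1\<close> and \<open>z2 - z1\<close>, which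
  have to differ.\<close>

definition top_two :: "(bool \<times> nat) multiset \<Rightarrow> nat set \<Rightarrow> nat \<Rightarrow> nat \<Rightarrow> bool" where
  "top_two M S z1 z2 \<longleftrightarrow> sum_rep M S {z1, z2} \<and> z1 < z2 \<and> z2 \<noteq> 2 * z1 \<and> (\<forall>s \<in> S. s = z1 \<or> s = z2 \<or> s < z1)"

definition free_prog :: "nat set \<Rightarrow> bool" where
  "free_prog S \<longleftrightarrow> (\<exists>h d. 0 < d \<and> d \<notin> S \<and> h \<in> S \<and> h + d \<in> S \<and> h + 2 * d \<in> S)"

text \<open>The difference of a progression is at most half of its last term, hence at most
  \<open>B\<close>, so new labels above \<open>B\<close> cannot coincide with it.\<close>

lemma free_prog_mono:
  assumes "free_prog S" "S \<subseteq> S'" "\<forall>s \<in> S' - S. B < s" "\<forall>s \<in> S. s \<le> 2 * B"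
  shows "free_prog S'"
proof -
  obtain h d where hd: "0 < d" "d \<notin> S" "h \<in> S" "h + d \<in> S" "h + 2 * d \<in> S"
    using assms(1) unfolding free_prog_def by blast
  have "h + 2 * d \<le> 2 * B" using hd(5) assms(4) by blast
  then have "\<not> B < d" by simp
  then have "d \<notin> S'" using hd(2) assms(3) by blast
  then show ?thesis using hd assms(2) unfolding free_prog_def by blast
qed

text \<open>Two distinct old labels sum to less than \<open>2 * z\<close>, so the new label is not a
  sum, and as a summand it is too large. The value \<open>2 * z\<close> is avoided because of the
  clause \<open>z2 \<noteq> 2 * z1\<close> in \<open>top_two\<close>.\<close>

lemma top_one_add_isolated:
  assumes "top_one M S z"
  shows "top_two M (insert (2 * z + 1) S) z (2 * z + 1)"
proof -
  let ?S = "insert (2 * z + 1) S"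
  have r: "sum_rep M S {z}" and le: "\<forall>s \<in> S. s \<le> z" and lt: "\<forall>s \<in> S. s = z \<or> s < z"
    using assms unfolding top_one_def by auto
  have S: "finite S" "z \<in> S" "0 \<notin> S" using r unfolding sum_rep_def by auto
  have z0: "z > 0" using S by (auto intro: gr0I)
  have "sum_edges ?S = sum_edges S"
  proof
    show "sum_edges ?S \<subseteq> sum_edges S"
    proof
      fix e assume "e \<in> sum_edges ?S"
      then obtain x y where xy: "x \<in> ?S" "y \<in> ?S" "x \<noteq> y" "x + y \<in> ?S" "e = {x, y}"
        unfolding sum_edges_def by blast
      have pos: "x > 0" "y > 0" using xy(1,2) S by (auto intro: gr0I)
      have "x + y \<le> 2 * z + 1" using xy(4) le by fastforce
      then have xS: "x \<in> S" "y \<in> S" using xy(1,2) pos by auto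
      then have "x \<le> z" "y \<le> z" using le by auto
      then have "x + y \<in> S" using xy(4) by auto
      then show "e \<in> sum_edges S" using xS xy unfolding sum_edges_def by blast
    qed
    show "sum_edges S \<subseteq> sum_edges ?S" unfolding sum_edges_def by blast
  qed
  moreover have "?S - {z, 2 * z + 1} = S - {z}" using le by force
  ultimately have "sum_rep M ?S {z, 2 * z + 1}" using r unfolding sum_rep_def by auto
  then show ?thesis using lt unfolding top_two_def by auto
qed

section \<open>Fibonacci chains\<close>

text \<open>
  The state of a Fibonacci-like path under construction: the labels \<open>us @ [p, q]\<close> form a path
  and \<open>p + q\<close> is the only label outside all components.
\<close>

definition chain :: "(bool \<times> nat) multiset \<Rightarrow> nat set \<Rightarrow> nat list \<Rightarrow> nat \<Rightarrow> nat \<Rightarrow> bool" where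
  "chain M S us p q \<longleftrightarrow> finite S \<and> 0 \<notin> S \<and> distinct (us @ [p, q, p + q]) \<and>
     set (us @ [p, q]) \<subseteq> S \<and> p + q \<in> S \<and> (\<forall>s \<in> S. s = q \<or> s = p + q \<or> s < q) \<and>
     (\<exists>cs E. mset (map shape cs) = M \<and> decomp (S - set (us @ [p, q]) - {p + q}) E cs \<and>
        sum_edges S = E \<union> path_edges (us @ [p, q]))"

text \<open>The new label \<open>z1 + z2\<close> joins the two formerly isolated labels by an edge,
  the first of a new path.\<close>

lemma top_two_chain:
  assumes "top_two M S z1 z2"
  shows "chain M (insert (z1 + z2) S) [] z1 z2"
proof -
  let ?S = "insert (z1 + z2) S"
  have r: "sum_rep M S {z1, z2}" and z: "z1 < z2" and lt: "\<forall>s \<in> S. s = z1 \<or> s = z2 \<or> s < z1"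
    using assms unfolding top_two_def by auto
  have S: "finite S" "z1 \<in> S" "z2 \<in> S" "0 \<notin> S" using r unfolding sum_rep_def by auto
  have z0: "z1 > 0" using S by (auto intro: gr0I)
  obtain cs where cs: "mset (map shape cs) = M" "decomp (S - {z1, z2}) (sum_edges S) cs"
    using r unfolding sum_rep_def by blast
  have "z1 + z2 \<notin> S"
  proof
    assume "z1 + z2 \<in> S"
    then show False using bspec[OF lt] z z0 by fastforce
  qed
  then have "?S - set ([] @ [z1, z2]) - {z1 + z2} = S - {z1, z2}" by auto
  moreover have "sum_edges ?S = sum_edges S \<union> path_edges ([] @ [z1, z2])"
    using sum_edges_insert_top[of z1 S z2] S z lt by simp
  ultimately have ex: "\<exists>cs E. mset (map shape cs) = M \<and>
      decomp (?S - set ([] @ [z1, z2]) - {z1 + z2}) E cs \<and>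
      sum_edges ?S = E \<union> path_edges ([] @ [z1, z2])" using cs by metis
  have "s = z2 \<or> s = z1 + z2 \<or> s < z2" if "s \<in> ?S" for s
    using lt z that by fastforce
  then show ?thesis unfolding chain_def using S z z0 ex by simp
qed

lemma chain_step:
  assumes "chain M S us p q"
  shows "chain M (insert (q + (p + q)) S) (us @ [p]) q (p + q)"
proof -
  let ?r = "p + q" let ?S = "insert (q + ?r) S" let ?ws = "us @ [p, q]"
  have S: "finite S" "0 \<notin> S" "distinct (us @ [p, q, ?r])" "set ?ws \<subseteq> S" "?r \<in> S"
    and lt: "\<forall>s \<in> S. s = q \<or> s = ?r \<or> s < q"
    using assms unfolding chain_def by auto
  obtain cs E where cs: "mset (map shape cs) = M" "decomp (S - set ?ws - {?r}) E cs"
      "sum_edges S = E \<union> path_edges ?ws"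
    using assms unfolding chain_def by blast
  have p0: "p > 0" "q > 0" using S by (auto intro: gr0I)
  have le: "s \<le> ?r" if "s \<in> S" for s
    using bspec[OF lt that] by auto
  have r': "q + ?r \<notin> S" using le[of "q + ?r"] p0 by auto
  have "sum_edges ?S = insert {q, ?r} (sum_edges S)"
    using sum_edges_insert_top[of q S ?r] S lt p0 by auto
  also have "\<dots> = E \<union> path_edges (?ws @ [?r])"
    unfolding cs(3) by (subst path_edges_snoc) auto
  finally have 1: "sum_edges ?S = E \<union> path_edges (?ws @ [?r])" .
  have 2: "?S - set (?ws @ [?r]) - {q + ?r} = S - set ?ws - {?r}"
    using r' by auto
  have 3: "s = ?r \<or> s = q + ?r \<or> s < ?r" if "s \<in> ?S" for s
    using le[of s] that by auto
  have 4: "distinct ((us @ [p]) @ [q, ?r, q + ?r])" using S r' by auto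
  have 5: "set (?ws @ [?r]) \<subseteq> ?S" using S by auto
  have eq: "(us @ [p]) @ [q, ?r] = ?ws @ [?r]" by simp
  have 6: "\<exists>cs E. mset (map shape cs) = M \<and> decomp (?S - set (?ws @ [?r]) - {q + ?r}) E cs \<and>
     sum_edges ?S = E \<union> path_edges (?ws @ [?r])"
    using 1 2 cs by metis
  show ?thesis unfolding chain_def eq
    using S(1,2) p0 3 4 5 6 by simp
qed

lemma chain_top_one:
  assumes "chain M S us p q"
  shows "top_one (add_mset (False, length us + 2) M) S (p + q)"
proof -
  let ?ws = "us @ [p, q]"
  have S: "finite S" "0 \<notin> S" "distinct (us @ [p, q, p + q])" "set ?ws \<subseteq> S" "p + q \<in> S"
    and lt: "\<forall>s \<in> S. s = q \<or> s = p + q \<or> s < q"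
    using assms unfolding chain_def by auto
  obtain cs E where cs: "mset (map shape cs) = M" "decomp (S - set ?ws - {p + q}) E cs"
      "sum_edges S = E \<union> path_edges ?ws"
    using assms unfolding chain_def by blast
  have "decomp (S - set ?ws - {p + q} \<union> set ?ws) (E \<union> comp_edges (False, ?ws)) ((False, ?ws) # cs)"
    using S(3) by (intro decomp_Cons cs) auto
  moreover have "S - set ?ws - {p + q} \<union> set ?ws = S - {p + q}" using S(3,4) by auto
  ultimately have "decomp (S - {p + q}) (sum_edges S) ((False, ?ws) # cs)" using cs(3) by simp
  moreover have "mset (map shape ((False, ?ws) # cs)) = add_mset (False, length us + 2) M"
    using cs(1) by (simp add: shape_def)
  ultimately have "sum_rep (add_mset (False, length us + 2) M) S {p + q}"
    unfolding sum_rep_def using S by blast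
  moreover have "s = p + q \<or> s < p + q" if "s \<in> S" for s
    using bspec[OF lt that] S by (auto intro: gr0I)
  ultimately show ?thesis unfolding top_one_def by blast
qed

text \<open>
  With \<open>r = p + q\<close>, the two largest labels \<open>q < r\<close> are the only ones that can take part in a sum
  exceeding \<open>q\<close>; this keeps the label \<open>q + hd us\<close> that closes the cycle from creating further edges.
\<close>

definition pair_bound :: "nat set \<Rightarrow> nat \<Rightarrow> nat \<Rightarrow> bool" where
  "pair_bound S q r \<longleftrightarrow> (\<forall>a \<in> S. \<forall>b \<in> S. a \<noteq> b \<longrightarrow> a \<notin> {q, r} \<longrightarrow> b \<notin> {q, r} \<longrightarrow> a + b \<le> q)"

lemma chain_close:
  assumes "chain M S us p q" "us \<noteq> []" "hd us < p" "p - hd us \<notin> S" "pair_bound S q (p + q)"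
  shows "top_two (add_mset (True, length us + 2) M) (insert (q + hd us) S) (q + hd us) (p + q)"
proof -
  define x where "x = hd us"
  let ?ws = "us @ [p, q]" let ?S = "insert (q + x) S"
  have S: "finite S" "0 \<notin> S" "distinct (us @ [p, q, p + q])" "set ?ws \<subseteq> S" "p + q \<in> S"
    and lt: "\<forall>s \<in> S. s = q \<or> s = p + q \<or> s < q"
    using assms(1) unfolding chain_def by auto
  obtain cs E where cs: "mset (map shape cs) = M" "decomp (S - set ?ws - {p + q}) E cs"
      "sum_edges S = E \<union> path_edges ?ws"
    using assms(1) unfolding chain_def by blast
  have xu: "x \<in> set us" unfolding x_def using assms(2) by simp
  then have xS: "x \<in> S" using S(4) by auto
  then have x0: "0 < x" using S(2) by (auto intro: gr0I)
  have xp: "x < p" using assms(3) x_def by simp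
  have pq: "p < q" using bspec[OF lt, of p] S x0 xp by auto
  have le: "s \<le> p + q" if "s \<in> S" for s using bspec[OF lt that] by auto
  have nS: "q + x \<notin> S" using bspec[OF lt, of "q + x"] x0 xp by auto
  have "sum_edges ?S = insert {q, x} (sum_edges S)"
  proof
    show "sum_edges ?S \<subseteq> insert {q, x} (sum_edges S)"
    proof
      fix e assume "e \<in> sum_edges ?S"
      then obtain a b where ab: "a \<in> ?S" "b \<in> ?S" "a \<noteq> b" "a + b \<in> ?S" "e = {a, b}"
        unfolding sum_edges_def by blast
      have pos: "a > 0" "b > 0" using ab(1,2) S(2) x0 by (auto intro: gr0I)
      \<comment> \<open>The new label is no summand: a sum with it exceeds \<open>q\<close>, so it
        could only be \<open>p + q\<close>, and the partner would be \<open>p - x\<close>.\<close>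
      have new: False if "u = q + x" "v \<in> S" "u + v \<in> ?S" "v > 0" for u v
      proof -
        have "u + v \<in> S" using that by auto
        then have "u + v = p + q" using bspec[OF lt, of "u + v"] that x0 by auto
        then have "v = p - x" using that xp by auto
        then show False using that(2) assms(4) x_def by simp
      qed
      have aS: "a \<in> S" using ab new[of a b] pos by auto
      have bS: "b \<in> S" using ab new[of b a] pos by (auto simp: add.commute)
      show "e \<in> insert {q, x} (sum_edges S)"
      proof (cases "a + b \<in> S")
        case True
        then show ?thesis using aS bS ab unfolding sum_edges_def by blast
      next
        case False
        then have s: "a + b = q + x" using ab(4) by auto
        then have "a \<noteq> p + q" "b \<noteq> p + q" using xp by auto
        \<comment> \<open>The new label is the sum of \<open>q\<close> and \<open>x\<close> only:
          without \<open>q\<close>, \<open>pair_bound\<close> keeps the sum at most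
          \<open>q\<close>, which is less than \<open>q + x\<close>.\<close>
        moreover have "a = q \<or> b = q"
          using assms(5) aS bS s ab(3) x0 calculation unfolding pair_bound_def by fastforce
        ultimately have "a = q \<and> b = x \<or> a = x \<and> b = q" using s by auto
        then show ?thesis using ab(5) by auto
      qed
    qed
    have "sum_edges S \<subseteq> sum_edges ?S" unfolding sum_edges_def by blast
    moreover have "{q, x} \<in> sum_edges ?S"
      unfolding sum_edges_def using xS S(4) xp pq by (intro CollectI exI[of _ q] exI[of _ x]) auto
    ultimately show "insert {q, x} (sum_edges S) \<subseteq> sum_edges ?S" by simp
  qed
  also have "\<dots> = E \<union> comp_edges (True, ?ws)"
    using cs(3) assms(2) by (auto simp: x_def)
  finally have 1: "sum_edges ?S = E \<union> comp_edges (True, ?ws)" .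
  have "decomp (S - set ?ws - {p + q} \<union> set ?ws) (E \<union> comp_edges (True, ?ws)) ((True, ?ws) # cs)"
    using S(3) assms(2) by (intro decomp_Cons cs) (auto simp: Suc_le_eq)
  moreover have "S - set ?ws - {p + q} \<union> set ?ws = ?S - {q + x, p + q}" using S(3,4) nS by auto
  ultimately have "decomp (?S - {q + x, p + q}) (sum_edges ?S) ((True, ?ws) # cs)"
    using 1 by simp
  moreover have "mset (map shape ((True, ?ws) # cs)) = add_mset (True, length us + 2) M"
    using cs(1) by (simp add: shape_def)
  ultimately have "sum_rep (add_mset (True, length us + 2) M) ?S {q + x, p + q}"
    unfolding sum_rep_def using S(1,2,5) x0 by (intro conjI) (blast, blast, simp, blast)
  moreover have "s = q + x \<or> s = p + q \<or> s < q + x" if "s \<in> ?S" for s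
    using lt that by fastforce
  ultimately show ?thesis unfolding top_two_def using xp pq x_def by auto
qed

text \<open>
  The condition \<open>hd us + p < q\<close> puts the difference \<open>q - hd us\<close> of the next step strictly between
  the consecutive labels \<open>p\<close> and \<open>q\<close>, so the longer path can be closed to a cycle.
\<close>

definition ready :: "nat set \<Rightarrow> nat list \<Rightarrow> nat \<Rightarrow> nat \<Rightarrow> bool" where
  "ready S us p q \<longleftrightarrow> us \<noteq> [] \<and> hd us < p \<and> hd us + p < q \<and>
     (\<forall>s \<in> S. s = p \<or> s = q \<or> s = p + q \<or> s < p) \<and> pair_bound S q (p + q)"

lemma ready_step:
  assumes "chain M S us p q" "ready S us p q"
  shows "ready (insert (q + (p + q)) S) (us @ [p]) q (p + q)"
    and "q - hd us \<notin> insert (q + (p + q)) S"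
proof -
  let ?S = "insert (q + (p + q)) S"
  have lt: "\<forall>s \<in> S. s = q \<or> s = p + q \<or> s < q" and "p \<in> S" "q \<in> S" "0 \<notin> S"
    using assms(1) unfolding chain_def by auto
  have u: "us \<noteq> []" "hd us < p" "hd us + p < q"
    and ltp: "\<forall>s \<in> S. s = p \<or> s = q \<or> s = p + q \<or> s < p" and pb: "pair_bound S q (p + q)"
    using assms(2) unfolding ready_def by auto
  have "hd us \<in> S" using assms(1) u(1) unfolding chain_def by auto
  then have x0: "0 < hd us" using \<open>0 \<notin> S\<close> by (auto intro: gr0I)
  show "q - hd us \<notin> ?S"
    using u x0 ltp by fastforce
  have "pair_bound ?S (p + q) (q + (p + q))"
    unfolding pair_bound_def
  proof (intro ballI impI)
    fix a b assume ab: "a \<in> ?S" "b \<in> ?S" "a \<noteq> b" "a \<notin> {p + q, q + (p + q)}" "b \<notin> {p + q, q + (p + q)}"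
    then have S: "a \<in> S" "b \<in> S" by auto
    \<comment> \<open>Apart from the two new top labels, the largest labels are \<open>q\<close> and
      then \<open>p\<close>, so distinct ones sum to at most \<open>p + q\<close>.\<close>
    then have "a = p \<or> a = q \<or> a < p" "b = p \<or> b = q \<or> b < p" using ltp ab by auto
    then show "a + b \<le> p + q" using u ab(3) by auto
  qed
  moreover have "\<forall>s \<in> ?S. s = q \<or> s = p + q \<or> s = q + (p + q) \<or> s < q" using lt by auto
  ultimately show "ready ?S (us @ [p]) q (p + q)"
    unfolding ready_def using u by auto
qed

text \<open>Besides the growth of the path, the conclusion records what is used later: the new
  labels exceed \<open>q\<close> (for \<open>free_prog_mono\<close>), and readiness persists, with
  the closing condition of \<open>chain_close\<close> available after at least one step.\<close>

lemma chain_iter: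
  assumes "chain M S us p q"
  shows "\<exists>S' us' p' q'. chain M S' us' p' q' \<and> length us' = length us + k \<and> S \<subseteq> S' \<and>
    (\<forall>s \<in> S' - S. q < s) \<and> q \<le> q' \<and>
    (ready S us p q \<longrightarrow> ready S' us' p' q' \<and> (0 < k \<or> p - hd us \<notin> S \<longrightarrow> p' - hd us' \<notin> S'))"
proof (induction k)
  case 0
  then show ?case using assms by (intro exI[of _ S] exI[of _ us] exI[of _ p] exI[of _ q]) auto
next
  case (Suc k)
  then obtain S' us' p' q' where c: "chain M S' us' p' q'" "length us' = length us + k" "S \<subseteq> S'"
    "\<forall>s \<in> S' - S. q < s" "q \<le> q'" and r: "ready S us p q \<longrightarrow> ready S' us' p' q'" by blast
  have pos: "0 < p'" "0 < q'" using c(1) unfolding chain_def by (auto intro: gr0I)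
  let ?T = "insert (q' + (p' + q')) S'"
  have "ready ?T (us' @ [p']) q' (p' + q') \<and> q' - hd (us' @ [p']) \<notin> ?T" if "ready S us p q"
    using ready_step[OF c(1)] r that by (auto simp: ready_def)
  moreover have "chain M ?T (us' @ [p']) q' (p' + q')" using chain_step[OF c(1)] .
  moreover have "\<forall>s \<in> ?T - S. q < s" using c pos by auto
  ultimately show ?case using c
    by (intro exI[of _ ?T] exI[of _ "us' @ [p']"] exI[of _ q'] exI[of _ "p' + q'"]) auto
qed

lemma top_two_bound: "top_two M S z1 z2 \<Longrightarrow> s \<in> S \<Longrightarrow> s \<le> z2"
  unfolding top_two_def by fastforce

lemma top_two_add_path:
  assumes "top_two M S z1 z2" "2 \<le> n"
  obtains S' z where "top_one (add_mset (False, n) M) S' z" "S \<subseteq> S'" "\<forall>s \<in> S' - S. z2 < s"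
proof -
  have z1: "0 < z1" using assms(1) unfolding top_two_def sum_rep_def by (auto intro: gr0I)
  obtain S' us' p' q' where c: "chain M S' us' p' q'" "length us' = n - 2"
    "insert (z1 + z2) S \<subseteq> S'" "\<forall>s \<in> S' - insert (z1 + z2) S. z2 < s"
    \<comment> \<open>The list \<open>us\<close> omits the last two path vertices \<open>p\<close>
      and \<open>q\<close>, hence \<open>n - 2\<close>.\<close>
    using chain_iter[OF top_two_chain[OF assms(1)], of "n - 2"] by auto
  have "top_one (add_mset (False, n) M) S' (p' + q')"
    using chain_top_one[OF c(1)] c(2) assms(2) by (simp only: le_add_diff_inverse2)
  moreover have "\<forall>s \<in> S' - S. z2 < s" using c(4) z1 by auto
  ultimately show thesis using that c(3) by blast
qed

text \<open>A triangle is closed at once. The chain on four vertices cannot be closed, since there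
  \<open>p - hd us\<close> is the label \<open>z2\<close>, but it is \<open>ready\<close>; thus any
  positive number of further steps makes closing possible, which covers all lengths from 5
  on.\<close>

lemma top_two_add_cycle:
  assumes "top_two M S z1 z2" "3 \<le> n" "n \<noteq> 4"
  obtains S' y1 y2 where "top_two (add_mset (True, n) M) S' y1 y2" "S \<subseteq> S'" "\<forall>s \<in> S' - S. z2 < s"
proof -
  have r: "sum_rep M S {z1, z2}" and zz: "z1 < z2" "z2 \<noteq> 2 * z1"
    and lt: "\<forall>s \<in> S. s = z1 \<or> s = z2 \<or> s < z1"
    using assms(1) unfolding top_two_def by auto
  then have z1: "0 < z1" and zS: "z1 \<in> S" "z2 \<in> S" "0 \<notin> S"
    unfolding sum_rep_def by (auto intro: gr0I)
  define S2 where "S2 = insert (z1 + z2) S"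
  define S3 where "S3 = insert (z2 + (z1 + z2)) S2"
  have c3: "chain M S3 [z1] z2 (z1 + z2)"
    using chain_step[OF top_two_chain[OF assms(1)]] unfolding S3_def S2_def by simp
  have pb3: "pair_bound S3 (z1 + z2) (z2 + (z1 + z2))"
    unfolding pair_bound_def
  proof (intro ballI impI)
    fix a b assume ab: "a \<in> S3" "b \<in> S3" "a \<noteq> b" "a \<notin> {z1 + z2, z2 + (z1 + z2)}"
      "b \<notin> {z1 + z2, z2 + (z1 + z2)}"
    then have "a \<in> S" "b \<in> S" unfolding S3_def S2_def by auto
    then have "a = z1 \<or> a = z2 \<or> a < z1" "b = z1 \<or> b = z2 \<or> b < z1" using lt by auto
    then show "a + b \<le> z1 + z2" using zz ab(3) by auto
  qed
  show thesis
  proof (cases "n = 3")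
    case True
    \<comment> \<open>If this difference were a label, it would be adjacent to the isolated label
      \<open>z1\<close>, with sum \<open>z2\<close>.\<close>
    have "z2 - z1 \<notin> S3"
    proof
      assume *: "z2 - z1 \<in> S3"
      then have "z2 - z1 \<in> S" unfolding S3_def S2_def using z1 by auto
      moreover have "z1 + (z2 - z1) \<in> S" using zS zz by simp
      moreover have "z2 - z1 \<noteq> z1" using zz by auto
      ultimately show False using sum_rep_isolated[OF r, of z1 "z2 - z1"] by auto
    qed
    then have "top_two (add_mset (True, 3) M) (insert (z1 + z2 + z1) S3) (z1 + z2 + z1) (z2 + (z1 + z2))"
      using chain_close[OF c3] zz pb3 by (simp add: numeral_3_eq_3)
    moreover have "\<forall>s \<in> insert (z1 + z2 + z1) S3 - S. z2 < s" using z1 zz unfolding S3_def S2_def by auto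
    moreover have "S \<subseteq> insert (z1 + z2 + z1) S3" unfolding S3_def S2_def by auto
    ultimately show thesis using that True by metis
  next
    case False
    then have n: "5 \<le> n" using assms by simp
    define S4 where "S4 = insert ((z1 + z2) + (z2 + (z1 + z2))) S3"
    have c4: "chain M S4 ([z1] @ [z2]) (z1 + z2) (z2 + (z1 + z2))"
      using chain_step[OF c3] unfolding S4_def by simp
    have "pair_bound S4 (z2 + (z1 + z2)) (z1 + z2 + (z2 + (z1 + z2)))"
      unfolding pair_bound_def
    proof (intro ballI impI)
      fix a b assume ab: "a \<in> S4" "b \<in> S4" "a \<noteq> b"
        "a \<notin> {z2 + (z1 + z2), z1 + z2 + (z2 + (z1 + z2))}"
        "b \<notin> {z2 + (z1 + z2), z1 + z2 + (z2 + (z1 + z2))}"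
      then have "a \<in> S \<or> a = z1 + z2" "b \<in> S \<or> b = z1 + z2" unfolding S4_def S3_def S2_def by auto
      then have "a = z1 + z2 \<or> a = z1 \<or> a = z2 \<or> a < z1" "b = z1 + z2 \<or> b = z1 \<or> b = z2 \<or> b < z1"
        using lt by auto
      then show "a + b \<le> z2 + (z1 + z2)" using zz ab(3) by auto
    qed
    moreover have "\<forall>s \<in> S4. s = z1 + z2 \<or> s = z2 + (z1 + z2) \<or> s = z1 + z2 + (z2 + (z1 + z2)) \<or> s < z1 + z2"
      unfolding S4_def S3_def S2_def using lt z1 zz by fastforce
    ultimately have r4: "ready S4 ([z1] @ [z2]) (z1 + z2) (z2 + (z1 + z2))"
      unfolding ready_def using zz z1 by simp
    obtain S' us p q where c: "chain M S' us p q" "length us = n - 2" "S4 \<subseteq> S'"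
      "\<forall>s \<in> S' - S4. z2 + (z1 + z2) < s" "z2 + (z1 + z2) \<le> q"
      and r': "ready S' us p q" "p - hd us \<notin> S'"
      \<comment> \<open>Here \<open>n - 4\<close> is positive, which supplies the closing
        condition.\<close>
      using chain_iter[OF c4, of "n - 4"] r4 n by auto
    have len: "length us + 2 = n" using c(2) n by simp
    have "top_two (add_mset (True, n) M) (insert (q + hd us) S') (q + hd us) (p + q)"
      using chain_close[OF c(1)] r' len unfolding ready_def by simp
    moreover have "z2 < s" if "s \<in> insert (q + hd us) S' - S" for s
    proof (cases "s \<in> S4")
      case True
      then show ?thesis using that z1 zz unfolding S4_def S3_def S2_def by auto
    next
      case False
      then have "s = q + hd us \<or> z2 + (z1 + z2) < s" using that c(4) by auto
      then show ?thesis using c(5) z1 by auto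
    qed
    moreover have "S \<subseteq> insert (q + hd us) S'" using c(3) unfolding S4_def S3_def S2_def by auto
    ultimately show thesis using that by metis
  qed
qed

section \<open>Adding 4-cycles\<close>

lemma sum_rep_scale:
  assumes "sum_rep M S Z" "0 < c"
  shows "sum_rep M ((*) c ` S) ((*) c ` Z)"
proof -
  have inj: "inj_on ((*) c) X" for X :: "nat set" using assms(2) by (simp add: inj_on_def)
  obtain cs where cs: "mset (map shape cs) = M" "decomp (S - Z) (sum_edges S) cs"
    and S: "finite S" "Z \<subseteq> S" "0 \<notin> S"
    using assms(1) unfolding sum_rep_def by blast
  have "sum_edges ((*) c ` S) = (`) ((*) c) ` sum_edges S"
  proof
    show "sum_edges ((*) c ` S) \<subseteq> (`) ((*) c) ` sum_edges S"
    proof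
      fix e assume "e \<in> sum_edges ((*) c ` S)"
      then obtain u v w where "u \<in> S" "v \<in> S" "w \<in> S" "u \<noteq> v" "c * u + c * v = c * w" "e = {c * u, c * v}"
        unfolding sum_edges_def by auto
      moreover from this have "w = u + v" using assms(2) by (simp flip: distrib_left)
      ultimately have "{u, v} \<in> sum_edges S" "e = (*) c ` {u, v}" unfolding sum_edges_def by auto
      then show "e \<in> (`) ((*) c) ` sum_edges S" by blast
    qed
    show "(`) ((*) c) ` sum_edges S \<subseteq> sum_edges ((*) c ` S)"
    proof
      fix e assume "e \<in> (`) ((*) c) ` sum_edges S"
      then obtain u v where "u \<in> S" "v \<in> S" "u \<noteq> v" "u + v \<in> S" "e = {c * u, c * v}"
        unfolding sum_edges_def by auto
      then show "e \<in> sum_edges ((*) c ` S)" unfolding sum_edges_def using assms(2)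
        by (intro CollectI exI[of _ "c * u"] exI[of _ "c * v"]) (auto simp flip: distrib_left)
    qed
  qed
  moreover have "(*) c ` S - (*) c ` Z = (*) c ` (S - Z)"
    using inj[of UNIV] by (simp add: image_set_diff)
  moreover have "decomp ((*) c ` (S - Z)) ((`) ((*) c) ` sum_edges S) (map (map_prod id (map ((*) c))) cs)"
    by (rule decomp_map[OF cs(2) inj])
  moreover have "mset (map shape (map (map_prod id (map ((*) c))) cs)) = M"
    using cs(1) by (simp add: multiset.map_comp comp_def)
  ultimately show ?thesis 
    unfolding sum_rep_def using S assms(2)
    by (intro conjI exI[of _ "map (map_prod id (map ((*) c))) cs"]) auto
qed

text \<open>Of the six pairs of vertices of a 4-cycle, only the two diagonals are not edges.\<close>

lemma C4_edges:
  assumes "x \<in> set [a, b, c, d]" "y \<in> set [a, b, c, d]" "x \<noteq> y" "{x, y} \<noteq> {a, c}" "{x, y} \<noteq> {b, d}"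
  shows "{x, y} \<in> comp_edges (True, [a, b, c, d])"
  using assms by (auto simp: doubleton_eq_iff)

text \<open>
  Modulo 4 the new labels are \<open>1, -1, 1, -1\<close>, so that a new label and a scaled old one can only
  sum to a new label, which would make the common difference of the progression a label.
\<close>

lemma sum_rep_add_C4:
  assumes "sum_rep M S Z" "free_prog S"
  obtains S' Z' where "sum_rep (add_mset (True, 4) M) S' Z'" "free_prog S'" "card Z' = card Z"
proof -
  obtain h0 d where p: "0 < d" "d \<notin> S" "h0 \<in> S" "h0 + d \<in> S" "h0 + 2 * d \<in> S"
    using assms(2) unfolding free_prog_def by blast
  have S: "finite S" "0 \<notin> S" "Z \<subseteq> S" using assms(1) unfolding sum_rep_def by auto
  then have "h0 \<noteq> 0" using p(3) by metis
  then obtain h where h: "h0 = Suc h" using not0_implies_Suc by auto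
  define S4 where "S4 = (*) 4 ` S"
  define Z4 where "Z4 = (*) 4 ` Z"
  define ws where "ws = [1, 4 * h + 3, 4 * d + 1, 4 * (h + d) + 3]"
  define S' where "S' = S4 \<union> set ws"
  have r4: "sum_rep M S4 Z4" unfolding S4_def Z4_def by (rule sum_rep_scale[OF assms(1)]) simp
  have old: "\<exists>u \<in> S. x = 4 * u" if "x \<in> S4" for x using that unfolding S4_def by auto
  have odd: "odd x" if "x \<in> set ws" for x using that unfolding ws_def by auto
  have even: "even x" if "x \<in> S4" for x using old[OF that] by auto
  have dw: "distinct ws" unfolding ws_def using p(1) by (simp; presburger)
  have cls: "x \<in> {1, 4 * d + 1} \<and> x mod 4 = 1 \<or> x \<in> {4 * h + 3, 4 * (h + d) + 3} \<and> x mod 4 = 3"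
    if x: "x \<in> set ws" for x
  proof -
    consider "x = 1" | "x = 4 * h + 3" | "x = 4 * d + 1" | "x = 4 * (h + d) + 3"
      using x unfolding ws_def by auto
    then show ?thesis by cases (simp, (simp; presburger)+)
  qed
  \<comment> \<open>The sum would be a new label in the residue class of \<open>x\<close> modulo 4.
    The two labels of a class differ by \<open>4 * d\<close>, which forces \<open>u = 0\<close> or
    \<open>u = d\<close>, and neither is in \<open>S\<close>.\<close>
  have key: "4 * u + x \<notin> S'" if "x \<in> set ws" "u \<in> S" for x u
  proof
    assume "4 * u + x \<in> S'"
    moreover have "odd (4 * u + x)" using odd[OF that(1)] by simp
    ultimately have "4 * u + x \<in> set ws" using even unfolding S'_def by blast
    moreover have "u \<noteq> 0" "u \<noteq> d" using that(2) S(2) p(2) by metis+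
    moreover have "(4 * u + x) mod 4 = x mod 4" by simp
    ultimately show False using cls[OF that(1)] cls[of "4 * u + x"] by auto
  qed
  have "4 * (h + 1) \<in> S4" "4 * (h + 1 + d) \<in> S4" "4 * (h + 1 + 2 * d) \<in> S4"
    unfolding S4_def by (rule imageI, use p(3-5) h in simp)+
  then have m: "4 * h + 4 \<in> S4" "4 * h + 4 + 4 * d \<in> S4" "4 * h + 4 + 8 * d \<in> S4"
    by (simp_all add: algebra_simps)
  \<comment> \<open>Every label is odd or a multiple of 4, while the sum over either diagonal of the
    new cycle is 2 modulo 4.\<close>
  have non: "x \<notin> S'" if "x mod 4 = 2" for x
  proof -
    have "even x" using that by presburger
    moreover have "x \<noteq> 4 * u" for u using that by auto
    ultimately show ?thesis using odd old unfolding S'_def by blast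
  qed
  have mixed: False if "x \<in> set ws" "y \<in> S4" "x + y \<in> S'" for x y
    using key[OF that(1)] old[OF that(2)] that(3) by (auto simp: add.commute)
  have E: "sum_edges S' = sum_edges S4 \<union> comp_edges (True, ws)"
  proof
    show "sum_edges S' \<subseteq> sum_edges S4 \<union> comp_edges (True, ws)"
    proof
      fix e assume "e \<in> sum_edges S'"
      then obtain x y where xy: "x \<in> S'" "y \<in> S'" "x \<noteq> y" "x + y \<in> S'" "e = {x, y}"
        unfolding sum_edges_def by blast
      consider "x \<in> S4" "y \<in> S4" | "x \<in> set ws" "y \<in> set ws"
        using mixed[of x y] mixed[of y x] xy(1,2,4) unfolding S'_def by (auto simp: add.commute)
      then show "e \<in> sum_edges S4 \<union> comp_edges (True, ws)"
      proof cases
        case 1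
        then have "x + y \<in> S4" using xy(4) odd even unfolding S'_def by fastforce
        then show ?thesis using 1 xy unfolding sum_edges_def by blast
      next
        case 2
        have "{x, y} \<noteq> {1, 4 * d + 1}" "{x, y} \<noteq> {4 * h + 3, 4 * (h + d) + 3}"
        proof -
          have "(1 + (4 * d + 1)) mod 4 = 2" "(4 * h + 3 + (4 * (h + d) + 3)) mod 4 = 2" by presburger+
          then have "1 + (4 * d + 1) \<notin> S'" "4 * h + 3 + (4 * (h + d) + 3) \<notin> S'"
            using non by blast+
          then show "{x, y} \<noteq> {1, 4 * d + 1}" "{x, y} \<noteq> {4 * h + 3, 4 * (h + d) + 3}"
            using xy(4) unfolding doubleton_eq_iff by (metis add.commute)+
        qed
        then have "{x, y} \<in> comp_edges (True, ws)"
          using C4_edges[OF 2[unfolded ws_def] xy(3)] unfolding ws_def by blast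
        then show ?thesis using xy(5) by blast
      qed
    qed
    have "sum_edges S4 \<subseteq> sum_edges S'" unfolding sum_edges_def S'_def by blast
    moreover have new: "{x, y} \<in> sum_edges S'" if "x \<in> set ws" "y \<in> set ws" "x \<noteq> y" "x + y \<in> S4" for x y
      using that unfolding sum_edges_def S'_def by blast
    have "4 * h + 3 \<noteq> 4 * d + 1" "4 * (h + d) + 3 \<noteq> 4 * d + 1" by presburger+
    then have "{1, 4 * h + 3} \<in> sum_edges S'" "{4 * h + 3, 4 * d + 1} \<in> sum_edges S'"
      "{4 * d + 1, 4 * (h + d) + 3} \<in> sum_edges S'" "{4 * (h + d) + 3, 1} \<in> sum_edges S'"
      using m by (intro new; simp add: ws_def algebra_simps)+
    then have "comp_edges (True, ws) \<subseteq> sum_edges S'" unfolding ws_def by simp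
    ultimately show "sum_edges S4 \<union> comp_edges (True, ws) \<subseteq> sum_edges S'" by blast
  qed
  have disj: "set ws \<inter> S4 = {}" using odd even by blast
  have Z: "Z4 \<subseteq> S4" "0 \<notin> S4" "finite S4" using r4 unfolding sum_rep_def by auto
  have "0 \<notin> set ws" unfolding ws_def by simp
  moreover have len: "length ws = 4" unfolding ws_def by simp
  ultimately have "sum_rep (add_mset (True, length ws) M) S' Z4"
    using Z disj dw E by (intro sum_rep_add[OF r4, of True ws]) (auto simp: S'_def simp del: comp_edges.simps)
  with len have "sum_rep (add_mset (True, 4) M) S' Z4" by metis
  \<comment> \<open>The scaled progression survives: \<open>d\<close> is not in \<open>S\<close>,
    and the new labels are odd, so \<open>4 * d\<close> is still not a label. Hence the step can be
    repeated.\<close>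
  moreover have "free_prog S'"
  proof -
    have "4 * d \<notin> S'"
      using odd p(2) unfolding S'_def S4_def by fastforce
    then show ?thesis
      unfolding free_prog_def using m p(1)
      by (intro exI[of _ "4 * h + 4"] exI[of _ "4 * d"]) (auto simp: S'_def algebra_simps)
  qed
  moreover have "card Z4 = card Z" unfolding Z4_def by (rule card_image) (simp add: inj_on_def)
  ultimately show thesis using that by blast
qed

lemma sum_rep_replicate_C4:
  assumes "sum_rep M S Z" "free_prog S"
  shows "\<exists>S' Z'. sum_rep (M + replicate_mset k (True, 4)) S' Z' \<and> free_prog S' \<and> card Z' = card Z"
proof (induction k)
  case 0
  then show ?case using assms by auto
next
  case (Suc k)
  then obtain S' Z' where "sum_rep (M + replicate_mset k (True, 4)) S' Z'" "free_prog S'" "card Z' = card Z"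
    by blast
  then show ?case using sum_rep_add_C4 by (metis replicate_mset_Suc union_mset_add_mset_right)
qed

text \<open>These are the label sets of the explicit starting configurations below; on each line the
  first witness is \<open>h\<close> and the second is \<open>d\<close>.\<close>

lemma free_prog_bases:
  "free_prog {1, 3, 4, 5}" "free_prog {1, 3, 4, 5, 7}" "free_prog {1, 3, 4, 5, 9, 14}" "free_prog {1, 4, 5, 7}"
  "free_prog {1, 4, 5, 7, 12}" "free_prog {2, 3, 4}" "free_prog {1, 2, 3, 6, 7, 10, 12, 16, 19, 28}"
        apply (unfold free_prog_def)
        apply (rule exI[of _ 1], rule exI[of _ 2], simp)
       apply (rule exI[of _ 1], rule exI[of _ 2], simp)
      apply (rule exI[of _ 1], rule exI[of _ 2], simp)
     apply (rule exI[of _ 1], rule exI[of _ 3], simp)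
    apply (rule exI[of _ 1], rule exI[of _ 3], simp)
   apply (rule exI[of _ 2], rule exI[of _ 1], simp)
  apply (rule exI[of _ 2], rule exI[of _ 4], simp)
  done

text \<open>Three isolated labels in progression and no component: the starting point for a single
  4-cycle.\<close>

lemma sum_rep_N3: "sum_rep {#} {2, 3, 4} {2, 3, 4}"
  using sum_edges_set[of "[2, 3, 4]"] by (simp add: sum_rep_def decomp_Nil)

text \<open>The set contains no three-term progression, so this labelling serves only for the graph
  that is a single edge.\<close>

lemma sum_rep_P2: "sum_rep {#(False, 2)#} {1, 4, 5} {5}"
  unfolding sum_rep_def
  using sum_edges_set[of "[1, 4, 5]"]
  by (simp, intro exI[of _ "[(False, [1, 4])]"]) (simp add: shape_def decomp_def insert_Diff_if)

text \<open>The extra isolated label 7 creates the progression 1, 4, 7, at the price of a second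
  isolated vertex; a 4-cycle is then added for the second exceptional graph.\<close>

lemma sum_rep_P2_two_isolated: "sum_rep {#(False, 2)#} {1, 4, 5, 7} {5, 7}"
  unfolding sum_rep_def
  using sum_edges_set[of "[1, 4, 5, 7]"]
  by (simp, intro exI[of _ "[(False, [1, 4])]"]) (simp add: shape_def decomp_def insert_Diff_if)

lemma top_one_2P2: "top_one {#(False, 2), (False, 2)#} {1, 4, 5, 7, 12} 12"
  unfolding sum_rep_def top_one_def
  using sum_edges_set[of "[1, 4, 5, 7, 12]"]
  by (simp, intro exI[of _ "[(False, [1, 4]), (False, [5, 7])]"])
    (simp add: shape_def decomp_def insert_Diff_if insert_commute numeral_2_eq_2)

lemma top_two_C3: "top_two {#(True, 3)#} {1, 3, 4, 5, 7} 5 7"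
  unfolding sum_rep_def top_two_def
  using sum_edges_set[of "[1, 3, 4, 5, 7]"]
  by (simp, intro exI[of _ "[(True, [1, 3, 4])]"]) (simp add: shape_def decomp_def insert_Diff_if insert_commute)

text \<open>The edge sums of the cycle 1, 2, 10, 6 are 3, 12, 16, 7, all on the other cycle. Those
  of the cycle 16, 12, 7, 3 are 28, 19, 10, 19, so only 19 and 28 are needed besides the
  cycles.\<close>

lemma top_two_2C4:
  "top_two {#(True, 4), (True, 4)#} {1, 2, 3, 6, 7, 10, 12, 16, 19, 28} 19 28"
proof -
  have "sum_edges {1, 2, 3, 6, 7, 10, 12, 16, 19, 28} =
      {{1, 2}, {2, 10}, {10, 6}, {6, 1}, {16, 12}, {12, 7}, {7, 3}, {3, 16}}"
    using sum_edges_set[of "[1, 2, 3, 6, 7, 10, 12, 16, 19, 28]"] by (auto simp: insert_commute)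
  then show ?thesis
    unfolding sum_rep_def top_two_def
    by (simp, intro exI[of _ "[(True, [1, 2, 10, 6]), (True, [16, 12, 7, 3])]"])
      (simp add: shape_def decomp_def insert_Diff_if insert_commute, simp add: eval_nat_numeral)
qed

text \<open>
  Starting with \<open>3, 1\<close> rather than in increasing order makes \<open>1, 3, 5\<close> a progression whose
  difference is not a label.
\<close>

lemma chain_P3: "chain {#} {1, 3, 4, 5} [3] 1 4"
proof -
  have "sum_edges {1, 3, 4, 5} = {{3, 1}, {1, 4}}"
    using sum_edges_set[of "[1, 3, 4, 5]"] by (auto simp: insert_commute)
  moreover have "{1, 3, 4, 5} - set ([3] @ [1, 4]) - {1 + 4} = ({} :: nat set)" by auto
  ultimately show ?thesis
    unfolding chain_def
    by (intro conjI exI[of _ "[]"] exI[of _ "{}"]) (simp_all add: decomp_Nil)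
qed

text \<open>The sequence 3, 1, 4 continued by two steps. This is its first stage that is
  \<open>ready\<close>, and it can be closed immediately because 5 - 3 = 2 is not a label.\<close>

lemma chain_P5: "chain {#} {1, 3, 4, 5, 9, 14} [3, 1, 4] 5 9"
proof -
  have "sum_edges {1, 3, 4, 5, 9, 14} = {{3, 1}, {1, 4}, {4, 5}, {5, 9}}"
    using sum_edges_set[of "[1, 3, 4, 5, 9, 14]"] by (auto simp: insert_commute)
  moreover have "{1, 3, 4, 5, 9, 14} - set ([3, 1, 4] @ [5, 9]) - {5 + 9} = ({} :: nat set)" by auto
  ultimately show ?thesis
    unfolding chain_def
    by (intro conjI exI[of _ "[]"] exI[of _ "{}"]) (simp_all add: decomp_Nil)
qed

lemma ready_P5: "ready {1, 3, 4, 5, 9, 14} [3, 1, 4] 5 9"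
  by (simp add: ready_def pair_bound_def)

lemma single_path:
  assumes "3 \<le> n"
  obtains S z where "top_one {#(False, n)#} S z" "free_prog S"
proof -
  obtain S us p q where c: "chain {#} S us p q" "length us = 1 + (n - 3)" "{1, 3, 4, 5} \<subseteq> S"
    "\<forall>s \<in> S - {1, 3, 4, 5}. 4 < s"
    using chain_iter[OF chain_P3, of "n - 3"] by auto
  have "length us + 2 = n" using c(2) assms by simp
  then have "top_one {#(False, n)#} S (p + q)" using chain_top_one[OF c(1)] by simp
  moreover have "free_prog S" by (rule free_prog_mono[OF free_prog_bases(1) c(3,4)]) simp
  ultimately show thesis using that by blast
qed

lemma single_cycle:
  assumes "3 \<le> n" "n \<noteq> 4"
  obtains S y1 y2 where "top_two {#(True, n)#} S y1 y2" "free_prog S"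
proof (cases "n = 3")
  case True
  then show thesis using that top_two_C3 free_prog_bases(2) by metis
next
  case False
  let ?B = "{1, 3, 4, 5, 9, 14} :: nat set"
  obtain S us p q where c: "chain {#} S us p q" "length us = 3 + (n - 5)" "?B \<subseteq> S"
    "\<forall>s \<in> S - ?B. 9 < s" "9 \<le> q" and r: "ready S us p q" "p - hd us \<notin> S"
    \<comment> \<open>For \<open>n = 5\<close> no step is taken, and the closing condition is the
      one of the starting chain.\<close>
    using chain_iter[OF chain_P5, of "n - 5"] ready_P5 by auto
  have n: "length us + 2 = n" using c(2) assms False by simp
  have "top_two {#(True, n)#} (insert (q + hd us) S) (q + hd us) (p + q)"
    using chain_close[OF c(1)] r n unfolding ready_def by simp
  moreover have "hd us \<in> S" using c(1) r(1) unfolding chain_def ready_def by auto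
  then have "0 < hd us" using c(1) unfolding chain_def by (auto intro: gr0I)
  then have "\<forall>s \<in> insert (q + hd us) S - ?B. 9 < s" using c(4,5) by auto
  then have "free_prog (insert (q + hd us) S)"
    using c(3) by (intro free_prog_mono[OF free_prog_bases(3)]) auto
  ultimately show thesis using that by blast
qed

section \<open>Labellings with few isolated vertices\<close>

text \<open>A second isolated label \<open>2 * z + 1\<close> is created first; the new path then
  absorbs both isolated labels and leaves one.\<close>

lemma top_one_add_path:
  assumes "top_one M S z" "free_prog S" "2 \<le> n"
  obtains S' z' where "top_one (add_mset (False, n) M) S' z'" "free_prog S'"
proof -
  let ?T = "insert (2 * z + 1) S"
  have t: "top_two M ?T z (2 * z + 1)" by (rule top_one_add_isolated[OF assms(1)])
  have "s \<le> z" if "s \<in> S" for s using assms(1) that unfolding top_one_def by auto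
  then have "free_prog ?T"
    using assms(2) by (intro free_prog_mono[of S ?T z]) fastforce+
  moreover obtain S' z' where *: "top_one (add_mset (False, n) M) S' z'" "?T \<subseteq> S'"
    "\<forall>s \<in> S' - ?T. 2 * z + 1 < s"
    using top_two_add_path[OF t assms(3)] .
  ultimately have "free_prog S'"
    using top_two_bound[OF t] by (intro free_prog_mono[of ?T S' "2 * z + 1"]) fastforce+
  then show thesis using that * by blast
qed

lemma top_one_add_paths:
  assumes "\<exists>S z. top_one M S z \<and> free_prog S" "\<forall>c \<in># B. \<not> fst c \<and> 2 \<le> snd c"
  shows "\<exists>S z. top_one (M + B) S z \<and> free_prog S"
  using assms(2)
proof (induction B)
  case empty
  then show ?case using assms(1) by simp
next
  case (add c B)
  obtain n where "c = (False, n)" "2 \<le> n" using add.prems by (cases c) auto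
  moreover obtain S z where "top_one (M + B) S z" "free_prog S" using add by auto
  ultimately show ?case using top_one_add_path[of "M + B" S z n] by (metis union_mset_add_mset_right)
qed

lemma top_two_add_paths:
  assumes "top_two M S z1 z2" "free_prog S" "\<forall>c \<in># B. \<not> fst c \<and> 2 \<le> snd c" "B \<noteq> {#}"
  shows "\<exists>S z. top_one (M + B) S z \<and> free_prog S"
proof -
  obtain c B' where B: "B = add_mset c B'" using assms(4) by (metis multiset_cases)
  then obtain n where c: "c = (False, n)" "2 \<le> n" using assms(3) by (cases c) auto
  obtain S' z where *: "top_one (add_mset (False, n) M) S' z" "S \<subseteq> S'" "\<forall>s \<in> S' - S. z2 < s"
    using top_two_add_path[OF assms(1) c(2)] .
  then have "free_prog S'"
    using top_two_bound[OF assms(1)] by (intro free_prog_mono[OF assms(2)]) fastforce+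
  then have "\<exists>S z. top_one (add_mset (False, n) M + B') S z \<and> free_prog S"
    using * B assms(3) by (intro top_one_add_paths) auto
  then show ?thesis unfolding B c by simp
qed

lemma cycles_top_two:
  assumes "\<forall>c \<in># A. fst c \<and> 3 \<le> snd c \<and> snd c \<noteq> 4" "A \<noteq> {#}"
  shows "\<exists>S z1 z2. top_two A S z1 z2 \<and> free_prog S"
  using assms
proof (induction A)
  case empty
  then show ?case by simp
next
  case (add c A)
  obtain n where n: "c = (True, n)" "3 \<le> n" "n \<noteq> 4" using add.prems by (cases c) auto
  show ?case
  proof (cases "A = {#}")
    case True
    then show ?thesis using single_cycle[OF n(2,3)] n(1) by metis
  next
    case False
    then obtain S z1 z2 where t: "top_two A S z1 z2" "free_prog S" using add by auto
    obtain S' y1 y2 where *: "top_two (add_mset (True, n) A) S' y1 y2" "S \<subseteq> S'" "\<forall>s \<in> S' - S. z2 < s"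
      using top_two_add_cycle[OF t(1) n(2,3)] .
    then have "free_prog S'"
      using top_two_bound[OF t(1)] by (intro free_prog_mono[OF t(2)]) fastforce+
    then show ?thesis using * n(1) by blast
  qed
qed

text \<open>Cycles come first and keep two isolated labels; the first path reduces them to one, and
  later paths keep one. Without cycles, the start is a path on at least three vertices or, if every
  path is a single edge, two of these edges together.\<close>

lemma ex_sum_rep_without_C4:
  assumes "\<forall>c \<in># A. fst c \<and> 3 \<le> snd c \<and> snd c \<noteq> 4" "\<forall>c \<in># B. \<not> fst c \<and> 2 \<le> snd c"
    and "A + B \<noteq> {#}" "A + B \<noteq> {#(False, 2)#}"
  shows "\<exists>S Z. sum_rep (A + B) S Z \<and> free_prog S \<and> card Z = (if B = {#} then 2 else 1)"
proof -
  have one: ?thesis if "\<exists>S z. top_one (A + B) S z \<and> free_prog S" "B \<noteq> {#}"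
    using that unfolding top_one_def by (metis card_1_singleton_iff One_nat_def)
  show ?thesis
  proof (cases "A = {#}")
    case False
    then obtain S z1 z2 where t: "top_two A S z1 z2" "free_prog S" using cycles_top_two assms(1) by blast
    show ?thesis
    proof (cases "B = {#}")
      case True
      then show ?thesis using t unfolding top_two_def
        by (intro exI[of _ S] exI[of _ "{z1, z2}"]) auto
    next
      case False
      then show ?thesis using top_two_add_paths[OF t assms(2)] one by blast
    qed
  next
    case True
    then have B: "B \<noteq> {#}" "B \<noteq> {#(False, 2)#}" using assms by auto
    have "\<exists>S z. top_one B S z \<and> free_prog S"
    proof (cases "\<exists>c \<in># B. snd c \<noteq> 2")
      case True
      then obtain n where n: "(False, n) \<in># B" "3 \<le> n"
        using assms(2) by (metis Suc_leI eval_nat_numeral(3) numeral_2_eq_2 numeral_3_eq_3 order_le_neq_trans prod.collapse)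
      then obtain B' where B': "B = add_mset (False, n) B'" by (metis insert_DiffM)
      have "\<exists>S z. top_one ({#(False, n)#} + B') S z \<and> free_prog S"
        using single_path[OF n(2)] assms(2) B' by (intro top_one_add_paths) (metis, auto)
      then show ?thesis using B' by simp
    next
      case False
      then have all: "c = (False, 2)" if "c \<in># B" for c using assms(2) that by (cases c) auto
      obtain B1 where B1: "B = add_mset (False, 2) B1" using B(1) all by (metis multiset_cases union_single_eq_member)
      have "B1 \<noteq> {#}" using B(2) B1 by auto
      then obtain c B2 where "B1 = add_mset c B2" by (metis multiset_cases)
      then have B2: "B1 = add_mset (False, 2) B2" using all B1 by simp
      have "\<exists>S z. top_one ({#(False, 2), (False, 2)#} + B2) S z \<and> free_prog S"
        using top_one_2P2 free_prog_bases(5) assms(2) B1 B2 by (intro top_one_add_paths) (metis, auto)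
      then show ?thesis using B1 B2 by simp
    qed
    then show ?thesis using one B(1) True by simp
  qed
qed

text \<open>\<open>A\<close> holds the cycles other than 4-cycles, \<open>B\<close> the paths, and
  the \<open>k\<close> 4-cycles are added last. Where \<open>A\<close> and \<open>B\<close> provide
  no progression, either the graph is a single edge, or \<open>k\<close> is at least 2 and two
  4-cycles serve as the start.\<close>

lemma ex_sum_rep:
  assumes val: "\<forall>c \<in># M. (if fst c then 3 else 2) \<le> snd c"
    and "M \<noteq> {#}" "M \<noteq> {#(True, 4)#}" "M \<noteq> {#(True, 4), (False, 2)#}"
  shows "\<exists>S Z. sum_rep M S Z \<and> card Z = (if \<exists>c \<in># M. \<not> fst c then 1 else 2)"
proof -
  define A where "A = {#c \<in># M. fst c \<and> snd c \<noteq> 4#}"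
  define B where "B = {#c \<in># M. \<not> fst c#}"
  define k where "k = count M (True, 4)"
  have M: "M = A + B + replicate_mset k (True, 4)"
    by (rule multiset_eqI) (auto simp: A_def B_def k_def count_eq_zero_iff split: prod.splits)
  have A: "\<forall>c \<in># A. fst c \<and> 3 \<le> snd c \<and> snd c \<noteq> 4" using val unfolding A_def by auto
  have B: "\<forall>c \<in># B. \<not> fst c \<and> 2 \<le> snd c" using val unfolding B_def by auto
  have Bn: "(\<exists>c \<in># M. \<not> fst c) \<longleftrightarrow> B \<noteq> {#}" unfolding B_def by (simp flip: set_mset_eq_empty_iff) force
  have AB: "B \<noteq> {#}" if "A + B = {#(False, 2)#}"
    using A that by auto
  show ?thesis
  proof (cases "A + B = {#} \<or> A + B = {#(False, 2)#}")
    case False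
    then obtain S Z where "sum_rep (A + B) S Z" "free_prog S" "card Z = (if B = {#} then 2 else 1)"
      using ex_sum_rep_without_C4[OF A B] by blast
    then show ?thesis using sum_rep_replicate_C4[of "A + B" S Z k] M Bn by (metis (no_types))
  next
    case True
    show ?thesis
    proof (cases "A + B = {#}")
      case True
      then have Mk: "M = replicate_mset k (True, 4)" and "B = {#}" using M by auto
      then have "k \<noteq> 0" "k \<noteq> 1" using assms by auto
      then have "M = {#(True, 4), (True, 4)#} + replicate_mset (k - 2) (True, 4)"
        using Mk by (cases k; cases "k - 1") auto
      moreover have "sum_rep {#(True, 4), (True, 4)#} {1, 2, 3, 6, 7, 10, 12, 16, 19, 28} {19, 28}"
        using top_two_2C4 unfolding top_two_def by blast
      ultimately obtain S Z where "sum_rep M S Z" "card Z = card {19, 28 :: nat}"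
        using sum_rep_replicate_C4 free_prog_bases(7) by (metis (no_types))
      moreover have "card {19, 28 :: nat} = 2" by simp
      ultimately show ?thesis using Bn \<open>B = {#}\<close> by metis
    next
      case False
      then have AB2: "A + B = {#(False, 2)#}"
        using \<open>A + B = {#} \<or> A + B = {#(False, 2)#}\<close> by blast
      then have "B \<noteq> {#}" using AB by simp
      have Mk: "M = {#(False, 2)#} + replicate_mset k (True, 4)" using M AB2 by simp
      have "\<exists>S Z. sum_rep M S Z \<and> card Z = 1"
      proof (cases "k = 0")
        case True
        then show ?thesis using sum_rep_P2 Mk by (intro exI[of _ "{1, 4, 5}"] exI[of _ "{5}"]) simp
      next
        case False
        moreover have "k \<noteq> 1" using Mk assms(4) by (auto simp: add_mset_commute)
        ultimately have k: "M = ({#(True, 4), (True, 4)#} + {#(False, 2)#}) + replicate_mset (k - 2) (True, 4)"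
          using Mk by (cases k; cases "k - 1") auto
        \<comment> \<open>The single edge is put on the isolated labels 19 and 28 of the two
          4-cycles, before the other 4-cycles are added.\<close>
        obtain S z where "top_one ({#(True, 4), (True, 4)#} + {#(False, 2)#}) S z" "free_prog S"
          using top_two_add_paths[OF top_two_2C4 free_prog_bases(7), of "{#(False, 2)#}"] by auto
        then obtain S' Z' where "sum_rep M S' Z'" "card Z' = card {z}"
          using sum_rep_replicate_C4[of _ S "{z}" "k - 2"] k unfolding top_one_def by (metis (no_types))
        then show ?thesis by auto
      qed
      then show ?thesis using Bn \<open>B \<noteq> {#}\<close> by auto
    qed
  qed
qed

lemma ex_sum_rep_C4: "\<exists>S Z. sum_rep {#(True, 4)#} S Z \<and> card Z = 3"
proof -
  obtain S' Z' where "sum_rep {#(True, 4)#} S' Z'" "card Z' = card {2, 3, 4 :: nat}"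
    using sum_rep_add_C4[OF sum_rep_N3 free_prog_bases(6)] .
  moreover have "card {2, 3, 4 :: nat} = 3" by simp
  ultimately show ?thesis by metis
qed

lemma ex_sum_rep_C4_P2: "\<exists>S Z. sum_rep {#(True, 4), (False, 2)#} S Z \<and> card Z = 2"
proof -
  obtain S' Z' where "sum_rep {#(True, 4), (False, 2)#} S' Z'" "card Z' = card {5, 7 :: nat}"
    using sum_rep_add_C4[OF sum_rep_P2_two_isolated free_prog_bases(4)] .
  moreover have "card {5, 7 :: nat} = 2" by simp
  ultimately show ?thesis by metis
qed

section \<open>Graphs of maximum degree two\<close>

lemma degree_two_nbr:
  assumes "finite E" "card {e \<in> E. v \<in> e} \<le> 2"
    and "{v, a} \<in> E" "{v, b} \<in> E" "{v, w} \<in> E" "a \<noteq> b"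
  shows "w = a \<or> w = b"
proof (rule ccontr)
  assume "\<not> ?thesis"
  then have "card {{v, a}, {v, b}, {v, w}} = 3" using assms(6) by (auto simp: doubleton_eq_iff)
  moreover have "card {{v, a}, {v, b}, {v, w}} \<le> card {e \<in> E. v \<in> e}"
    using assms by (intro card_mono) auto
  ultimately show False using assms(2) by simp
qed

text \<open>Take a longest path. Its interior vertices already have their two edges, and by
  maximality an edge at an end leads back to the path; so it is a path edge or joins the two
  ends.\<close>

lemma ex_component:
  assumes "finite V" "V \<noteq> {}"
    and E: "E \<subseteq> {{x, y} | x y. x \<in> V \<and> y \<in> V \<and> x \<noteq> y}"
    and nbr: "\<forall>v \<in> V. \<exists>e \<in> E. v \<in> e"
    and deg: "\<forall>v \<in> V. card {e \<in> E. v \<in> e} \<le> 2"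
  obtains b ws where "valid_comp (b, ws)" "distinct ws" "set ws \<subseteq> V" "comp_edges (b, ws) \<subseteq> E"
    "\<forall>e \<in> E. e \<inter> set ws \<noteq> {} \<longrightarrow> e \<in> comp_edges (b, ws)"
proof -
  have "E \<subseteq> Pow V" using E by blast
  then have finE: "finite E" using assms(1) by (meson finite_Pow_iff finite_subset)
  have inV: "u \<in> V" "w \<in> V" "u \<noteq> w" if "{u, w} \<in> E" for u w
    using that E by (auto simp: doubleton_eq_iff)
  define P where "P ws \<longleftrightarrow> distinct ws \<and> set ws \<subseteq> V \<and> 2 \<le> length ws \<and> path_edges ws \<subseteq> E" for ws
  obtain v where "v \<in> V" using assms(2) by blast
  then obtain e where "e \<in> E" "v \<in> e" using nbr by blast
  moreover from this obtain x y where "e = {x, y}" using E by blast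
  ultimately have "P [x, y]" unfolding P_def using inV[of x y] by auto
  moreover have "\<forall>ws. P ws \<longrightarrow> length ws < Suc (card V)"
    unfolding P_def using assms(1) by (metis card_mono distinct_card less_Suc_eq_le)
  \<comment> \<open>A path has distinct vertices in \<open>V\<close>, so its length is bounded by
    \<open>card V\<close>.\<close>
  ultimately obtain ws where P: "P ws" and max: "\<And>us. P us \<Longrightarrow> length us \<le> length ws"
    using ex_has_greatest_nat[of P "[x, y]" length "Suc (card V)"] by (meson order_less_imp_le)
  have ws: "distinct ws" "set ws \<subseteq> V" "2 \<le> length ws" "path_edges ws \<subseteq> E"
    using P unfolding P_def by auto
  let ?n = "length ws"
  have ne: "ws \<noteq> []" using ws(3) by auto
  have step: "{ws ! i, ws ! Suc i} \<in> path_edges ws" if "Suc i < ?n" for i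
    using that unfolding path_edges_nth by blast
  have interior: "{ws ! i, w} \<in> path_edges ws" if i: "0 < i" "Suc i < ?n" and w: "{ws ! i, w} \<in> E" for i w
  proof -
    obtain j where j: "i = Suc j" using i(1) not0_implies_Suc by blast
    have l: "{ws ! i, ws ! j} \<in> path_edges ws" using step[of j] i(2) j by (simp add: insert_commute)
    have r: "{ws ! i, ws ! Suc i} \<in> path_edges ws" using step i(2) by blast
    have "ws ! j \<noteq> ws ! Suc i" using ws(1) i(2) j by (simp add: nth_eq_iff_index_eq)
    moreover have "ws ! i \<in> V" using ws(2) i(2) by (meson Suc_lessD nth_mem subsetD)
    ultimately have "w = ws ! j \<or> w = ws ! Suc i"
      using degree_two_nbr[OF finE _ _ _ w] l r ws(4) deg by blast
    then show ?thesis using l r by auto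
  qed
  have hd_edge: "{hd ws, w} \<in> path_edges ws \<or> {hd ws, w} = {last ws, hd ws}" if w: "{hd ws, w} \<in> E" for w
  proof -
    have "w \<in> set ws"
    proof (rule ccontr)
      assume "w \<notin> set ws"
      moreover have "path_edges (w # ws) = insert {w, hd ws} (path_edges ws)"
        using ne by (cases ws) auto
      ultimately have "P (w # ws)" unfolding P_def using ws w inV[OF w] by (auto simp: insert_commute)
      then show False using max by fastforce
    qed
    then obtain j where j: "j < ?n" "w = ws ! j" by (metis in_set_conv_nth)
    have "j \<noteq> 0" using inV(3)[OF w] j ne by (metis hd_conv_nth)
    consider "Suc j < ?n" | "j = ?n - 1" using j(1) by linarith
    then show ?thesis
    proof cases
      case 1
      then show ?thesis using interior[of j "hd ws"] \<open>j \<noteq> 0\<close> w j by (simp add: insert_commute)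
    next
      case 2
      then show ?thesis using j ne by (auto simp: last_conv_nth)
    qed
  qed
  have last_edge: "{last ws, w} \<in> path_edges ws \<or> {last ws, w} = {last ws, hd ws}" if w: "{last ws, w} \<in> E" for w
  proof -
    have "w \<in> set ws"
    proof (rule ccontr)
      assume "w \<notin> set ws"
      moreover have "path_edges (ws @ [w]) = insert {last ws, w} (path_edges ws)"
        using ne by (rule path_edges_snoc)
      ultimately have "P (ws @ [w])" unfolding P_def using ws w inV[OF w] by auto
      then show False using max by fastforce
    qed
    then obtain j where j: "j < ?n" "w = ws ! j" by (metis in_set_conv_nth)
    have "j \<noteq> ?n - 1" using inV(3)[OF w] j ne by (metis last_conv_nth)
    then have "Suc j < ?n" using j(1) by linarith
    then show ?thesis using interior[of j "last ws"] w j ne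
      by (cases "j = 0") (auto simp: insert_commute hd_conv_nth)
  qed
  have all: "e \<in> path_edges ws \<or> e = {last ws, hd ws}" if e: "e \<in> E" "e \<inter> set ws \<noteq> {}" for e
  proof -
    obtain u where u: "u \<in> e" "u \<in> set ws" using e(2) by blast
    moreover obtain x y where "e = {x, y}" using e(1) E by blast
    ultimately obtain w where w: "e = {u, w}" by (metis insertE insert_commute singletonD)
    obtain i where i: "i < ?n" "u = ws ! i" using u(2) by (metis in_set_conv_nth)
    consider "i = 0" | "0 < i" "Suc i < ?n" | "i = ?n - 1" using i(1) by linarith
    then show ?thesis
    proof cases
      case 1
      then show ?thesis using hd_edge[of w] e(1) w i ne by (simp add: hd_conv_nth)
    next
      case 2
      then show ?thesis using interior e(1) w i by blast
    next
      case 3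
      then show ?thesis using last_edge[of w] e(1) w i ne by (simp add: last_conv_nth)
    qed
  qed
  show thesis
  proof (cases "3 \<le> ?n \<and> {last ws, hd ws} \<in> E")
    case True
    then show thesis using that[of True ws] ws all by auto
  next
    case False
    \<comment> \<open>With only two vertices, the edge joining the ends is the path edge
      itself.\<close>
    have "{last ws, hd ws} \<in> path_edges ws" if "{last ws, hd ws} \<in> E"
    proof -
      have "?n = Suc (Suc 0)" using False that ws(3) by linarith
      then obtain x y where "ws = [x, y]" by (auto simp: length_Suc_conv)
      then show ?thesis by (simp add: insert_commute)
    qed
    then show thesis using that[of False ws] ws all by auto
  qed
qed

text \<open>No edge leaves the component found, so the remaining vertices keep all their edges, and
  induction on the number of vertices applies.\<close>

lemma ex_decomp:
  assumes "finite V" "E \<subseteq> {{x, y} | x y. x \<in> V \<and> y \<in> V \<and> x \<noteq> y}"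
    and "\<forall>v \<in> V. \<exists>e \<in> E. v \<in> e" "\<forall>v \<in> V. card {e \<in> E. v \<in> e} \<le> 2"
  shows "\<exists>cs. decomp V E cs"
  using assms
proof (induction "card V" arbitrary: V E rule: less_induct)
  case less
  show ?case
  proof (cases "V = {}")
    case True
    then have "E = {}" using less.prems(2) by blast
    then show ?thesis using True by (intro exI[of _ "[]"]) (simp add: decomp_def)
  next
    case False
    obtain b ws where c: "valid_comp (b, ws)" "distinct ws" "set ws \<subseteq> V" "comp_edges (b, ws) \<subseteq> E"
      "\<forall>e \<in> E. e \<inter> set ws \<noteq> {} \<longrightarrow> e \<in> comp_edges (b, ws)"
      using ex_component[OF less.prems(1) False less.prems(2-4)] .
    define V' where "V' = V - set ws"
    define E' where "E' = E - comp_edges (b, ws)"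
    have sub: "e \<subseteq> set ws" if "e \<in> comp_edges (b, ws)" for e
      using comp_edges_subset[OF c(1) that] by simp
    have finE: "finite E" using less.prems(1,2) by (rule_tac finite_subset[of _ "Pow V"]) auto
    have "ws \<noteq> []" using c(1) by (auto split: if_splits)
    then have "card V' < card V" unfolding V'_def using c(3) less.prems(1)
      by (intro psubset_card_mono) (auto simp: neq_Nil_conv)
    moreover have "finite V'" unfolding V'_def using less.prems(1) by simp
    moreover have "E' \<subseteq> {{x, y} | x y. x \<in> V' \<and> y \<in> V' \<and> x \<noteq> y}"
    proof
      fix e assume e: "e \<in> E'"
      then have "e \<inter> set ws = {}" using c(5) unfolding E'_def by blast
      moreover obtain x y where "e = {x, y}" "x \<in> V" "y \<in> V" "x \<noteq> y"
        using e less.prems(2) unfolding E'_def by blast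
      ultimately show "e \<in> {{x, y} | x y. x \<in> V' \<and> y \<in> V' \<and> x \<noteq> y}"
        unfolding V'_def by blast
    qed
    moreover have "\<forall>v \<in> V'. \<exists>e \<in> E'. v \<in> e"
      using less.prems(3) sub unfolding V'_def E'_def by blast
    moreover have "\<forall>v \<in> V'. card {e \<in> E'. v \<in> e} \<le> 2"
    proof
      fix v assume "v \<in> V'"
      then have "card {e \<in> E. v \<in> e} \<le> 2" using less.prems(4) unfolding V'_def by blast
      moreover have "card {e \<in> E'. v \<in> e} \<le> card {e \<in> E. v \<in> e}"
        unfolding E'_def using finE by (intro card_mono) auto
      ultimately show "card {e \<in> E'. v \<in> e} \<le> 2" by linarith
    qed
    ultimately obtain cs where "decomp V' E' cs" using less.hyps by blast
    then have "decomp (V' \<union> set ws) (E' \<union> comp_edges (b, ws)) ((b, ws) # cs)"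
      using c(1,2) by (intro decomp_Cons) (auto simp: V'_def)
    moreover have "V' \<union> set ws = V" "E' \<union> comp_edges (b, ws) = E"
      using c(3,4) unfolding V'_def E'_def by blast+
    ultimately show ?thesis by metis
  qed
qed

section \<open>Sum labellings of graphs\<close>

text \<open>The labelling is injective on vertices, hence on sets of vertices, so the two edge sets
  can be compared after taking images. This is where edges must consist of vertices.\<close>

lemma sum_labelling_iff:
  assumes "\<forall>e \<in> edges H. e \<subseteq> verts H"
  shows "sum_labelling H l \<longleftrightarrow>
    inj_on l (verts H) \<and> 0 \<notin> l ` verts H \<and> (`) l ` edges H = sum_edges (l ` verts H)"
proof -
  let ?X = "{{x, y} | x y. x \<in> verts H \<and> y \<in> verts H \<and> x \<noteq> y \<and> (\<exists>z \<in> verts H. l z = l x + l y)}"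
  have eq: "edges H = ?X \<longleftrightarrow> (`) l ` edges H = sum_edges (l ` verts H)" if inj: "inj_on l (verts H)"
  proof -
    have "(`) l ` ?X = sum_edges (l ` verts H)"
    proof
      show "(`) l ` ?X \<subseteq> sum_edges (l ` verts H)"
      proof
        fix e assume "e \<in> (`) l ` ?X"
        then obtain x y z where "x \<in> verts H" "y \<in> verts H" "x \<noteq> y" "z \<in> verts H"
          "l z = l x + l y" "e = {l x, l y}" by auto
        moreover from this have "l x \<noteq> l y" "l x + l y \<in> l ` verts H"
          using inj by (auto dest: inj_onD) (metis imageI)
        ultimately show "e \<in> sum_edges (l ` verts H)" unfolding sum_edges_def by blast
      qed
      show "sum_edges (l ` verts H) \<subseteq> (`) l ` ?X"
      proof
        fix e assume "e \<in> sum_edges (l ` verts H)"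
        then obtain x y z where xyz: "x \<in> verts H" "y \<in> verts H" "l x \<noteq> l y" "z \<in> verts H"
          "l z = l x + l y" "e = {l x, l y}" unfolding sum_edges_def by auto
        then have "{x, y} \<in> ?X" by blast
        moreover have "e = l ` {x, y}" using xyz by simp
        ultimately show "e \<in> (`) l ` ?X" by blast
      qed
    qed
    moreover have "(`) l ` edges H = (`) l ` ?X \<longleftrightarrow> edges H = ?X"
      using assms by (intro inj_on_image_eq_iff[OF inj_on_image_Pow[OF inj]]) auto
    ultimately show ?thesis by simp
  qed
  have "(\<forall>v \<in> verts H. 1 \<le> l v) \<longleftrightarrow> 0 \<notin> l ` verts H" by (auto simp: Suc_le_eq)
  moreover have "sum_labelling H l \<longleftrightarrow> inj_on l (verts H) \<and> (\<forall>v \<in> verts H. 1 \<le> l v) \<and> edges H = ?X"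
    by (simp only: sum_labelling_def)
  ultimately show ?thesis using eq by argo
qed

section \<open>Translation between added edgeless graphs and sets of labels\<close>

lemma disjoint_union_edgeless:
  "verts (disjoint_union G (edgeless_graph k)) = verts G <+> {..<k}"
  "edges (disjoint_union G (edgeless_graph k)) = (`) Inl ` edges G"
  by (simp_all add: disjoint_union_def edgeless_graph_def)

text \<open>A labelling gives \<open>S\<close> as its image and \<open>Z\<close> as the labels of
  the edgeless part. Conversely, equal shapes give an isomorphism from \<open>G\<close> onto
  \<open>S - Z\<close>, which any bijection onto \<open>Z\<close> extends to a labelling.\<close>

lemma sum_graph_iff:
  assumes cs: "decomp (verts G) (edges G) cs"
  shows "sum_graph (disjoint_union G (edgeless_graph k)) \<longleftrightarrow>
    (\<exists>S Z. sum_rep (mset (map shape cs)) S Z \<and> card Z = k)"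
proof -
  let ?H = "disjoint_union G (edgeless_graph k)"
  have V: "finite (verts G)" using cs unfolding decomp_def by auto
  have sub: "\<forall>e \<in> edges ?H. e \<subseteq> verts ?H"
  proof
    fix e assume "e \<in> edges ?H"
    then obtain e' where "e' \<in> edges G" "e = Inl ` e'" unfolding disjoint_union_edgeless by blast
    moreover from this have "e' \<subseteq> verts G" using decomp_edge_subset[OF cs] by blast
    ultimately show "e \<subseteq> verts ?H" unfolding disjoint_union_edgeless by blast
  qed
  show ?thesis
  proof
    assume "sum_graph ?H"
    then obtain l where "sum_labelling ?H l" unfolding sum_graph_def by blast
    then have l: "inj_on l (verts G <+> {..<k})" "0 \<notin> l ` (verts G <+> {..<k})"
      "(`) l ` (`) Inl ` edges G = sum_edges (l ` (verts G <+> {..<k}))"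
      using sum_labelling_iff[OF sub, of l] unfolding disjoint_union_edgeless by blast+
    define S where "S = l ` (verts G <+> {..<k})"
    define Z where "Z = l ` Inr ` {..<k}"
    have sub': "Inl ` verts G \<subseteq> verts G <+> {..<k}" "Inr ` {..<k} \<subseteq> verts G <+> {..<k}"
      unfolding Plus_def by blast+
    have "card (Inr ` {..<k} :: ('a + nat) set) = k" by (simp add: card_image)
    then have Z: "card Z = k"
      unfolding Z_def by (simp only: card_image[OF inj_on_subset[OF l(1) sub'(2)]])
    have "verts G <+> {..<k} - Inr ` {..<k} = Inl ` verts G" unfolding Plus_def by blast
    moreover have "l ` (verts G <+> {..<k} - Inr ` {..<k}) = S - Z" unfolding S_def Z_def
      by (rule inj_on_image_set_diff[OF l(1) Diff_subset sub'(2)])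
    ultimately have SZ: "S - Z = (l \<circ> Inl) ` verts G" by (simp add: image_comp)
    have "inj_on (l \<circ> Inl) (verts G)"
      by (rule comp_inj_on[OF inj_Inl inj_on_subset[OF l(1) sub'(1)]])
    then have "decomp ((l \<circ> Inl) ` verts G) ((`) (l \<circ> Inl) ` edges G) (map (map_prod id (map (l \<circ> Inl))) cs)"
      by (rule decomp_map[OF cs])
    moreover have "(`) (l \<circ> Inl) ` edges G = sum_edges S"
      using l(3) unfolding S_def by (simp add: image_comp comp_def)
    moreover have "mset (map shape (map (map_prod id (map (l \<circ> Inl))) cs)) = mset (map shape cs)"
      by (simp add: multiset.map_comp comp_def)
    moreover have "finite S" "Z \<subseteq> S" "0 \<notin> S" using V l(2) unfolding S_def Z_def by auto
    ultimately have "sum_rep (mset (map shape cs)) S Z" unfolding sum_rep_def SZ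
      by (intro conjI exI[of _ "map (map_prod id (map (l \<circ> Inl))) cs"]) simp_all
    then show "\<exists>S Z. sum_rep (mset (map shape cs)) S Z \<and> card Z = k" using Z by blast
  next
    assume "\<exists>S Z. sum_rep (mset (map shape cs)) S Z \<and> card Z = k"
    then obtain S Z cs' where S: "finite S" "Z \<subseteq> S" "0 \<notin> S" "card Z = k"
      and cs': "mset (map shape cs') = mset (map shape cs)" "decomp (S - Z) (sum_edges S) cs'"
      unfolding sum_rep_def by blast
    obtain f where f: "bij_betw f (verts G) (S - Z)" "sum_edges S = (`) f ` edges G"
      using decomp_iso[OF cs cs'(2)] cs'(1) by metis
    have "finite Z" using S finite_subset by blast
    then obtain g where g: "bij_betw g {..<k} Z"
      using ex_bij_betw_nat_finite[of Z] S(4) by (metis atLeast0LessThan)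
    define l where "l = case_sum f g"
    have im: "l ` (verts G <+> {..<k}) = S"
    proof -
      have "l ` (verts G <+> {..<k}) = f ` verts G \<union> g ` {..<k}"
        unfolding l_def Plus_def by (simp add: image_Un image_comp)
      also have "\<dots> = S" using f(1) g S(2) unfolding bij_betw_def by auto
      finally show ?thesis .
    qed
    have disj: "f x \<noteq> g i" if "x \<in> verts G" "i < k" for x i
      using f(1) g that unfolding bij_betw_def by blast
    have "inj_on l (verts G <+> {..<k})"
    proof (rule inj_onI)
      fix x y assume *: "x \<in> verts G <+> {..<k}" "y \<in> verts G <+> {..<k}" "l x = l y"
      have "inj_on f (verts G)" "inj_on g {..<k}" using f(1) g by (simp_all add: bij_betw_def)
      then show "x = y"
        using * disj[of _ _] disj[symmetric] unfolding l_def
        by (cases x; cases y) (auto dest: inj_onD)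
    qed
    moreover have "(`) l ` (`) Inl ` edges G = sum_edges S"
      unfolding f(2) l_def by (simp add: image_comp comp_def)
    ultimately have "sum_labelling ?H l"
      unfolding sum_labelling_iff[OF sub] unfolding disjoint_union_edgeless im using S(3) by blast
    then show "sum_graph ?H" unfolding sum_graph_def by blast
  qed
qed

text \<open>At the vertex \<open>v\<close> of \<open>G\<close> with the largest label, the edge sums
  exceed all labels of \<open>G\<close>; they are distinct by injectivity, so the degree of
  \<open>v\<close> is at most \<open>k\<close>.\<close>

lemma min_degree_le_isolated:
  assumes "simple_graph G" "verts G \<noteq> {}" "sum_graph (disjoint_union G (edgeless_graph k))"
  shows "min_degree G \<le> k"
proof -
  let ?H = "disjoint_union G (edgeless_graph k)"
  obtain l where l: "sum_labelling ?H l" using assms(3) unfolding sum_graph_def by blast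
  have fin: "finite (verts G)" and E: "edges G \<subseteq> {{x, y} | x y. x \<in> verts G \<and> y \<in> verts G \<and> x \<noteq> y}"
    using assms(1) unfolding simple_graph_def by auto
  define f where "f = l \<circ> Inl"
  obtain v where v: "v \<in> verts G" "\<And>u. u \<in> verts G \<Longrightarrow> f u \<le> f v"
  proof -
    have "Max (f ` verts G) \<in> f ` verts G" using fin assms(2) by simp
    then obtain v where "v \<in> verts G" "f v = Max (f ` verts G)" by (metis imageE)
    then show thesis using that fin by simp
  qed
  have inj: "inj_on f (verts G)"
  proof -
    have "inj_on l (verts G <+> {..<k})"
      using l unfolding sum_labelling_def disjoint_union_edgeless by blast
    then have "inj_on l (Inl ` verts G)" by (rule inj_on_subset) (auto simp: Plus_def)
    then show ?thesis unfolding f_def by (rule comp_inj_on[OF inj_Inl])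
  qed
  have edge: "\<exists>w \<in> verts G. w \<noteq> v \<and> e = {v, w} \<and> f v + f w \<in> (l \<circ> Inr) ` {..<k}"
    if e: "e \<in> edges G" "v \<in> e" for e
  proof -
    obtain w where w: "w \<in> verts G" "w \<noteq> v" "e = {v, w}" using e E by blast
    have "Inl ` e \<in> edges ?H" using e(1) unfolding disjoint_union_edgeless by blast
    moreover have "edges ?H = {{x, y} | x y. x \<in> verts ?H \<and> y \<in> verts ?H \<and> x \<noteq> y \<and>
        (\<exists>z \<in> verts ?H. l z = l x + l y)}"
      using l[unfolded sum_labelling_def] by (elim conjE)
    ultimately have "Inl ` e \<in> {{x, y} | x y. x \<in> verts ?H \<and> y \<in> verts ?H \<and> x \<noteq> y \<and>
        (\<exists>z \<in> verts ?H. l z = l x + l y)}" by simp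
    then obtain x y z where "Inl ` e = {x, y}" "z \<in> verts ?H" "l z = l x + l y" "x \<noteq> y"
      by blast
    then have z: "z \<in> verts ?H" "l z = f v + f w"
      using w unfolding f_def by (auto simp: doubleton_eq_iff)
    have "Inl w \<in> verts ?H" using w unfolding disjoint_union_edgeless by blast
    moreover have "\<forall>v \<in> verts ?H. 1 \<le> l v" using l[unfolded sum_labelling_def] by (elim conjE)
    ultimately have "1 \<le> f w" unfolding f_def by simp
    then have "z \<notin> Inl ` verts G" using z(2) v(2) unfolding f_def by fastforce
    then have "l z \<in> (l \<circ> Inr) ` {..<k}" using z(1) unfolding disjoint_union_edgeless by auto
    then have "f v + f w \<in> (l \<circ> Inr) ` {..<k}" using z(2) by simp
    then show ?thesis using w by blast
  qed
  \<comment> \<open>For an edge \<open>{v, w}\<close>, \<open>sum f e\<close> is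
    \<open>f v + f w\<close>, written as a function of the edge alone.\<close>
  have "inj_on (\<lambda>e. sum f e) {e \<in> edges G. v \<in> e}"
  proof (rule inj_onI)
    fix e e' assume e: "e \<in> {e \<in> edges G. v \<in> e}" "e' \<in> {e \<in> edges G. v \<in> e}" "sum f e = sum f e'"
    obtain w where w: "w \<in> verts G" "w \<noteq> v" "e = {v, w}" using edge[of e] e(1) by blast
    obtain w' where w': "w' \<in> verts G" "w' \<noteq> v" "e' = {v, w'}" using edge[of e'] e(2) by blast
    have "sum f e = f v + f w" "sum f e' = f v + f w'" using w w' by simp_all
    then have "f w = f w'" using e(3) by simp
    then have "w = w'" using inj_onD[OF inj] w(1) w'(1) by blast
    then show "e = e'" using w(3) w'(3) by simp
  qed
  moreover have "(\<lambda>e. sum f e) ` {e \<in> edges G. v \<in> e} \<subseteq> (l \<circ> Inr) ` {..<k}"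
  proof
    fix s assume "s \<in> sum f ` {e \<in> edges G. v \<in> e}"
    then obtain e where "e \<in> edges G" "v \<in> e" "s = sum f e" by blast
    with edge[of e] show "s \<in> (l \<circ> Inr) ` {..<k}" by auto
  qed
  ultimately have "card {e \<in> edges G. v \<in> e} \<le> card ((l \<circ> Inr) ` {..<k})"
    by (rule card_inj_on_le) simp
  also have "\<dots> \<le> k" by (metis card_image_le card_lessThan finite_lessThan)
  finally have "degree G v \<le> k" unfolding degree_def .
  moreover have "min_degree G \<le> degree G v" unfolding min_degree_def using fin v(1) by simp
  ultimately show ?thesis by linarith
qed

section \<open>Minimum degree of a union of cycles\<close>

lemma cycle_degree:
  assumes "distinct ws" "3 \<le> length ws" "v \<in> set ws"
  shows "\<exists>e e'. e \<in> comp_edges (True, ws) \<and> e' \<in> comp_edges (True, ws) \<and> v \<in> e \<and> v \<in> e' \<and> e \<noteq> e'"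
proof -
  let ?n = "length ws"
  obtain i where i: "i < ?n" "v = ws ! i" using assms(3) by (metis in_set_conv_nth)
  have path: "{ws ! i, ws ! Suc i} \<in> comp_edges (True, ws)" if "Suc i < ?n" for i
    using that by (auto simp: path_edges_nth)
  have cyc: "{ws ! (?n - 1), ws ! 0} \<in> comp_edges (True, ws)"
    using assms(2) by (cases "ws = []") (auto simp: last_conv_nth hd_conv_nth)
  have eq: "ws ! a = ws ! b \<longleftrightarrow> a = b" if "a < ?n" "b < ?n" for a b
    using assms(1) that by (simp add: nth_eq_iff_index_eq)
  \<comment> \<open>\<open>a\<close> and \<open>b\<close> are the cyclic predecessor and successor
    of \<open>i\<close>; they differ because the length is at least 3.\<close>
  define a where "a = (if i = 0 then ?n - 1 else i - 1)"
  define b where "b = (if i = ?n - 1 then 0 else Suc i)"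
  have ab: "a < ?n" "b < ?n" "a \<noteq> b" "a \<noteq> i" "b \<noteq> i"
    using i(1) assms(2) unfolding a_def b_def by auto
  have "{ws ! i, ws ! a} \<in> comp_edges (True, ws)"
    using cyc path[of "i - 1"] i(1) unfolding a_def by (auto simp: insert_commute simp del: comp_edges.simps)
  moreover have "{ws ! i, ws ! b} \<in> comp_edges (True, ws)"
    using cyc path[of i] i(1) unfolding b_def by (auto simp: insert_commute simp del: comp_edges.simps)
  moreover have "{ws ! i, ws ! a} \<noteq> {ws ! i, ws ! b}"
    using ab eq i(1) by (auto simp: doubleton_eq_iff)
  ultimately show ?thesis using i(2) by blast
qed

lemma min_degree_cycles:
  assumes "decomp (verts G) (edges G) cs" "verts G \<noteq> {}" "\<forall>c \<in> set cs. fst c"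
  shows "2 \<le> min_degree G"
proof -
  have fin: "finite (verts G)" using assms(1) unfolding decomp_def by auto
  have "edges G \<subseteq> Pow (verts G)" using decomp_edge_subset[OF assms(1)] by blast
  then have finE: "finite (edges G)" using fin by (meson finite_Pow_iff finite_subset)
  have "2 \<le> degree G v" if v: "v \<in> verts G" for v
  proof -
    obtain c where c: "c \<in> set cs" "v \<in> set (snd c)" using v assms(1) unfolding decomp_def by auto
    obtain ws where ws: "c = (True, ws)" using assms(3) c(1) by (cases c) auto
    have "valid_comp c" "comp_edges c \<subseteq> edges G" using c(1) assms(1) unfolding decomp_def by blast+
    moreover have "distinct ws"
    proof -
      have "distinct (concat (map snd cs))" using assms(1) unfolding decomp_def by blast
      moreover have "ws \<in> set (map snd cs)" using c(1) ws by force
      ultimately show ?thesis unfolding distinct_concat_iff by blast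
    qed
    ultimately obtain e e' where "e \<in> edges G" "e' \<in> edges G" "v \<in> e" "v \<in> e'" "e \<noteq> e'"
      using cycle_degree[of ws v] c(2) unfolding ws by auto
    then have "card {e, e'} \<le> degree G v" unfolding degree_def using finE by (intro card_mono) auto
    then show ?thesis using \<open>e \<noteq> e'\<close> by simp
  qed
  then show ?thesis unfolding min_degree_def using fin assms(2) by simp
qed

section \<open>The exceptional graphs\<close>

lemma sum_edgesD: "{u, v} \<in> sum_edges S \<Longrightarrow> u + v \<in> S"
  unfolding sum_edges_def by (auto simp: doubleton_eq_iff add.commute)

lemma sum_rep_list:
  assumes "sum_rep (mset ys) S Z"
  obtains cs where "map shape cs = ys" "decomp (S - Z) (sum_edges S) cs"
proof -
  obtain cs where "mset (map shape cs) = mset ys" "decomp (S - Z) (sum_edges S) cs"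
    using assms unfolding sum_rep_def by blast
  moreover from this(1) obtain cs' where "mset cs' = mset cs" "map shape cs' = ys"
    using mset_map_eqE by blast
  ultimately show thesis using that decomp_mset[of _ _ cs cs'] by simp
qed

lemma length_4_conv: "length ws = 4 \<longleftrightarrow> (\<exists>a b c d. ws = [a, b, c, d])"
  by (auto simp: eval_nat_numeral length_Suc_conv)

lemma length_2_conv: "length ws = 2 \<longleftrightarrow> (\<exists>a b. ws = [a, b])"
  by (auto simp: eval_nat_numeral length_Suc_conv)

lemma maximum_of_four:
  fixes a b c d :: nat
  assumes "distinct [a, b, c, d]"
  shows "b < a \<and> c < a \<and> d < a \<or> a < b \<and> c < b \<and> d < b \<or> a < c \<and> b < c \<and> d < c \<or>
    a < d \<and> b < d \<and> c < d"
proof -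
  have "a \<noteq> b" "a \<noteq> c" "a \<noteq> d" "b \<noteq> c" "b \<noteq> d" "c \<noteq> d" using assms by auto
  then show ?thesis by presburger
qed

text \<open>The two edge sums at the largest cycle label \<open>a\<close> must be the isolated
  labels, so these are \<open>a + b\<close> and \<open>d + a\<close>. Few values remain for
  \<open>b + c\<close> and \<open>c + d\<close>; every combination gives \<open>b = d\<close>,
  \<open>c = 0\<close>, or an edge at an isolated label.\<close>

lemma C4_two_isolated_top:
  fixes a b c d x y :: nat
  assumes S: "S = {a, b, c, d, x, y}" "0 \<notin> S" "distinct [a, b, c, d, x, y]"
    and E: "sum_edges S = {{a, b}, {b, c}, {c, d}, {d, a}}"
    and top: "b < a" "c < a" "d < a"
  shows False
proof -
  have pos: "0 < a" "0 < b" "0 < c" "0 < d" using S(1,2) by auto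
  have "{a, b} \<in> sum_edges S" "{b, c} \<in> sum_edges S" "{c, d} \<in> sum_edges S" "{d, a} \<in> sum_edges S"
    unfolding E by auto
  then have sums: "a + b \<in> S" "b + c \<in> S" "c + d \<in> S" "d + a \<in> S" by (simp_all add: sum_edgesD)
  have non: "u + v \<notin> S" if "u \<in> S" "v \<in> {x, y}" "u \<noteq> v" for u v
  proof
    assume "u + v \<in> S"
    then have "{u, v} \<in> sum_edges S" using that S(1) unfolding sum_edges_def by blast
    then have "v \<in> {a, b, c, d}" unfolding E by blast
    then show False using that(2) S(3) by auto
  qed
  have "a + b \<in> {x, y}" "d + a \<in> {x, y}" using sums(1,4) S(1) top pos by auto
  moreover have "b \<noteq> d" using S(3) by auto
  ultimately have xy: "{x, y} = {a + b, d + a}" by auto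
  then have S': "S = {a, b, c, d, a + b, d + a}" using S(1) by auto
  have ne: "b + (a + b) \<noteq> d + a" "c + (a + b) \<noteq> d + a" "c + (d + a) \<noteq> a + b" "d + (d + a) \<noteq> a + b"
    using non[of b "a + b"] non[of c "a + b"] non[of c "d + a"] non[of d "d + a"] xy S' pos top by auto
  have "b + c = a \<or> b + c = d \<or> b + c = d + a" using sums(2) S' pos top by auto
  moreover have "c + d = a \<or> c + d = b \<or> c + d = a + b" using sums(3) S' pos top by auto
  ultimately show False using ne pos \<open>b \<noteq> d\<close> top by linarith
qed

lemma not_sum_rep_C4_two:
  assumes "sum_rep {#(True, 4)#} S Z"
  shows "card Z \<noteq> 2"
proof
  assume "card Z = 2"
  then obtain x y where Z: "Z = {x, y}" "x \<noteq> y" by (auto simp: card_2_iff)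
  have "sum_rep (mset [(True, 4)]) S Z" using assms by simp
  then obtain cs where cs: "map shape cs = [(True, 4)]" "decomp (S - Z) (sum_edges S) cs"
    by (rule sum_rep_list)
  then obtain ws where "cs = [(True, ws)]" "length ws = 4" by (auto simp: shape_def)
  then obtain a b c d where "cs = [(True, [a, b, c, d])]" by (auto simp: length_4_conv)
  then have *: "S - Z = {a, b, c, d}" "distinct [a, b, c, d]" "sum_edges S = {{d, a}, {a, b}, {b, c}, {c, d}}"
    using cs(2) unfolding decomp_def by auto
  have 0: "0 \<notin> S" "Z \<subseteq> S" using assms unfolding sum_rep_def by auto
  have S: "S = {a, b, c, d, x, y}" using * 0 Z by auto
  have dist: "distinct [a, b, c, d, x, y]" using * Z by auto
  \<comment> \<open>A rotation of the cycle puts its largest label first.\<close>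
  consider "b < a" "c < a" "d < a" | "a < b" "c < b" "d < b" | "a < c" "b < c" "d < c" | "a < d" "b < d" "c < d"
    using maximum_of_four[of a b c d] *(2) by fastforce
  then show False
  proof cases
    case 1
    show ?thesis by (rule C4_two_isolated_top[of S a b c d x y]) (use 1 S 0 dist * in auto)
  next
    case 2
    show ?thesis by (rule C4_two_isolated_top[of S b c d a x y]) (use 2 S 0 dist * in auto)
  next
    case 3
    show ?thesis by (rule C4_two_isolated_top[of S c d a b x y]) (use 3 S 0 dist * in auto)
  next
    case 4
    show ?thesis by (rule C4_two_isolated_top[of S d a b c x y]) (use 4 S 0 dist * in auto)
  qed
qed

text \<open>The sum \<open>p + q\<close> must be the isolated label, and then the two edge sums at
  \<open>a\<close> are forced to be \<open>p\<close> and \<open>q\<close>. Each way to place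
  \<open>b + c\<close> and \<open>c + d\<close> gives \<open>b = d\<close> or makes a cycle label
  adjacent to \<open>p\<close>.\<close>

lemma C4_P2_one_isolated_top:
  fixes a b c d p q z :: nat
  assumes S: "S = {a, b, c, d, p, q, z}" "0 \<notin> S" "distinct [a, b, c, d, p, q, z]"
    and E: "sum_edges S = {{a, b}, {b, c}, {c, d}, {d, a}, {p, q}}"
    and top: "b < a" "c < a" "d < a" "p < q" "b < d"
  shows False
proof -
  have pos: "0 < a" "0 < b" "0 < c" "0 < d" "0 < p" "0 < q" using S(1,2) by auto
  have "{a, b} \<in> sum_edges S" "{b, c} \<in> sum_edges S" "{c, d} \<in> sum_edges S" "{d, a} \<in> sum_edges S"
    "{p, q} \<in> sum_edges S"
    unfolding E by auto
  then have sums: "a + b \<in> S" "b + c \<in> S" "c + d \<in> S" "d + a \<in> S" "p + q \<in> S"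
    by (simp_all add: sum_edgesD)
  have non: "u + v \<notin> S" if "u \<in> {b, c}" "v \<in> {p, q}" for u v
  proof
    assume "u + v \<in> S"
    moreover have "u \<noteq> v" using that S(3) by auto
    ultimately have "{u, v} \<in> sum_edges S" using that S(1) unfolding sum_edges_def by blast
    then show False using that S(3) unfolding E by (auto simp: doubleton_eq_iff)
  qed
  have ab: "a + b \<in> {p, q, z}" "d + a \<in> {p, q, z}" using sums(1,4) S(1) top pos by auto
  \<comment> \<open>\<open>a + b\<close> and \<open>d + a\<close> are two different members of
    \<open>{p, q, z}\<close>, so at least one of them is \<open>p\<close> or
    \<open>q\<close>.\<close>
  have "a < q" using ab top pos by auto
  then have z: "z = p + q" using sums(5) S(1) pos top by auto
  have "d \<in> S" "p \<in> S" "q \<in> S" using S(1) by auto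
  then have ne: "b + p \<noteq> d" "b + p \<noteq> q" "c + p \<noteq> q" "b + q \<noteq> d"
    using non[of b p] non[of c p] non[of b q] by auto
  have "d + a \<le> p + q" using ab(2) z by auto
  then have abpq: "a + b = p \<or> a + b = q" using ab(1) z top by auto
  have "d + a \<noteq> p + q" using abpq ne(1,4) by linarith
  moreover have "d + a \<noteq> p" using abpq top by linarith
  ultimately have "d + a = q" using ab(2) z by auto
  moreover from this have "a + b = p" using abpq top by linarith
  ultimately have pq: "a + b = p" "d + a = q" by simp_all
  have "b + c = a \<or> b + c = d" using sums(2) S(1) z pq pos top by auto
  moreover have "c + d = a \<or> c + d = p" using sums(3) S(1) z pq pos top by auto
  ultimately show False using ne pq pos top by linarith
qed

lemma not_sum_rep_C4_P2_one:
  assumes "sum_rep {#(True, 4), (False, 2)#} S Z"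
  shows "card Z \<noteq> 1"
proof
  assume "card Z = 1"
  then obtain z where Z: "Z = {z}" by (auto simp: card_1_singleton_iff)
  have "sum_rep (mset [(True, 4), (False, 2)]) S Z" using assms by simp
  then obtain cs where cs: "map shape cs = [(True, 4), (False, 2)]" "decomp (S - Z) (sum_edges S) cs"
    by (rule sum_rep_list)
  then obtain ws us where "cs = [(True, ws), (False, us)]" "length ws = 4" "length us = 2"
    by (auto simp: shape_def)
  then obtain a b c d p q where "cs = [(True, [a, b, c, d]), (False, [p, q])]"
    by (auto simp: length_4_conv length_2_conv)
  then have *: "S - Z = {a, b, c, d, p, q}" "distinct [a, b, c, d, p, q]"
      "sum_edges S = {{d, a}, {a, b}, {b, c}, {c, d}, {p, q}}"
    using cs(2) unfolding decomp_def by auto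
  have 0: "0 \<notin> S" "Z \<subseteq> S" using assms unfolding sum_rep_def by auto
  have S: "S = {a, b, c, d, p, q, z}" using * 0 Z by auto
  have dist: "distinct [a, b, c, d, p, q, z]" using * Z by auto
  \<comment> \<open>\<open>Q\<close> collects the conditions invariant under the symmetries
    \<open>flip\<close>, \<open>rot\<close> and \<open>refl\<close>, which allow
    \<open>p < q\<close>, \<open>a\<close> largest on the cycle, and \<open>b < d\<close> to be
    assumed.\<close>
  define Q where "Q a b c d p q \<longleftrightarrow> S = {a, b, c, d, p, q, z} \<and> distinct [a, b, c, d, p, q, z] \<and>
    sum_edges S = {{a, b}, {b, c}, {c, d}, {d, a}, {p, q}}" for a b c d p q
  have Q: "Q a b c d p q" unfolding Q_def using S dist * by auto
  have flip: "Q a b c d q p" if "Q a b c d p q" for a b c d p q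
  proof -
    have "{a, b, c, d, q, p, z} = {a, b, c, d, p, q, z}" "{q, p} = {p, q}" by blast+
    moreover have "distinct [a, b, c, d, q, p, z]" using that unfolding Q_def by auto
    ultimately show ?thesis using that unfolding Q_def by metis
  qed
  have rot: "Q b c d a p q" if "Q a b c d p q" for a b c d p q
  proof -
    have "{b, c, d, a, p, q, z} = {a, b, c, d, p, q, z}" by blast
    moreover have "{A, B, C, D, F} = {B, C, D, A, F}" for A B C D F :: "nat set" by blast
    moreover have "distinct [b, c, d, a, p, q, z]" using that unfolding Q_def by auto
    ultimately show ?thesis using that unfolding Q_def by metis
  qed
  have refl: "Q a d c b p q" if "Q a b c d p q" for a b c d p q
  proof -
    have "{a, d, c, b, p, q, z} = {a, b, c, d, p, q, z}" by blast
    moreover have "{{a, d}, {d, c}, {c, b}, {b, a}, {p, q}} = {{a, b}, {b, c}, {c, d}, {d, a}, {p, q}}"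
    proof -
      have comm: "{a, d} = {d, a}" "{d, c} = {c, d}" "{c, b} = {b, c}" "{b, a} = {a, b}" by blast+
      have "{A, B, C, D, F} = {D, C, B, A, F}" for A B C D F :: "nat set" by blast
      then show ?thesis unfolding comm .
    qed
    moreover have "distinct [a, d, c, b, p, q, z]" using that unfolding Q_def by auto
    ultimately show ?thesis using that unfolding Q_def by metis
  qed
  have 1: False if "Q a b c d p q" "b < a" "c < a" "d < a" "p < q" "b < d" for a b c d p q
    using C4_P2_one_isolated_top[of S a b c d p q z] that 0(1) unfolding Q_def by blast
  have 2: False if "Q a b c d p q" "b < a" "c < a" "d < a" "p < q" for a b c d p q
  proof -
    have "b \<noteq> d" using that(1) unfolding Q_def by auto
    then show False using 1[OF that(1)] 1[OF refl[OF that(1)]] that(2-5) by linarith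
  qed
  have 3: False if "Q a b c d p q" "b < a" "c < a" "d < a" for a b c d p q
  proof -
    have "p \<noteq> q" using that(1) unfolding Q_def by auto
    then show False using 2[OF that(1)] 2[OF flip[OF that(1)]] that(2-4) by linarith
  qed
  consider "b < a" "c < a" "d < a" | "a < b" "c < b" "d < b" | "a < c" "b < c" "d < c" | "a < d" "b < d" "c < d"
    using maximum_of_four[of a b c d] dist by fastforce
  then show False
    using 3[OF Q] 3[OF rot[OF Q]] 3[OF rot[OF rot[OF Q]]] 3[OF rot[OF rot[OF rot[OF Q]]]] by cases auto
qed

section \<open>Recognising the exceptional graphs by their decompositions\<close>

lemma graph_iso_decomp:
  assumes "graph_iso G H" "simple_graph G" "decomp (verts H) (edges H) ds"
  obtains cs where "decomp (verts G) (edges G) cs" "map shape cs = map shape ds"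
proof -
  obtain f where f: "bij_betw f (verts G) (verts H)" "edges H = (`) f ` edges G"
    using assms(1) unfolding graph_iso_def by blast
  define g where "g = inv_into (verts G) f"
  have "inj_on g (verts H)" "g ` verts H = verts G"
    using bij_betw_inv_into[OF f(1)] unfolding g_def bij_betw_def by auto
  moreover have "(`) g ` edges H = edges G"
  proof -
    have "g ` f ` e = e" if "e \<in> edges G" for e
    proof -
      have "e \<subseteq> verts G" using that assms(2) unfolding simple_graph_def by blast
      then show ?thesis unfolding g_def
        using inv_into_image_cancel[of f "verts G" e] f(1) by (simp add: bij_betw_def)
    qed
    then show ?thesis unfolding f(2) by (simp add: image_comp)
  qed
  ultimately have "decomp (verts G) (edges G) (map (map_prod id (map g)) ds)"
    using decomp_map[OF assms(3), of g] by simp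
  moreover have "map shape (map (map_prod id (map g)) ds) = map shape ds" by simp
  ultimately show thesis by (rule that)
qed

lemma decomp_graph_iso:
  assumes "decomp (verts G) (edges G) cs" "decomp (verts H) (edges H) ds"
    and "mset (map shape cs) = mset (map shape ds)"
  shows "graph_iso G H"
proof -
  obtain f where "bij_betw f (verts G) (verts H)" "edges H = (`) f ` edges G"
    using decomp_iso[OF assms] .
  then show ?thesis unfolding graph_iso_def by blast
qed

lemma decomp_C4: "decomp (verts (cycle_graph 4)) (edges (cycle_graph 4)) [(True, [0, 1, 2, 3])]"
proof -
  have "{..<4} = {3, 0, 1, 2 :: nat}" by auto
  moreover have "{{i, (i + 1) mod 4} | i :: nat. i < 4} = (\<lambda>i. {i, (i + 1) mod 4}) ` {..<4}"
    by blast
  ultimately have "verts (cycle_graph 4) = {3, 0, 1, 2}"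
    "edges (cycle_graph 4) = {{3, 0}, {0, 1}, {1, 2}, {2, 3}}"
    unfolding cycle_graph_def by (simp, simp, simp add: numeral_2_eq_2)
  then show ?thesis unfolding decomp_def by auto
qed

lemma decomp_P2: "decomp (verts (path_graph 2)) (edges (path_graph 2)) [(False, [0, 1])]"
proof -
  have "i + 1 < 2 \<longleftrightarrow> i = 0" for i :: nat by auto
  moreover have "{..<2} = {0, 1 :: nat}" by auto
  ultimately show ?thesis unfolding decomp_def path_graph_def by simp
qed

lemma decomp_append:
  assumes "decomp V E cs" "decomp V' E' ds" "V \<inter> V' = {}"
  shows "decomp (V \<union> V') (E \<union> E') (cs @ ds)"
  using assms unfolding decomp_def by (auto simp del: valid_comp.simps comp_edges.simps)

lemma decomp_disjoint_union:
  assumes "decomp (verts G) (edges G) cs" "decomp (verts H) (edges H) ds"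
  shows "decomp (verts (disjoint_union G H)) (edges (disjoint_union G H))
    (map (map_prod id (map Inl)) cs @ map (map_prod id (map Inr)) ds)"
proof -
  have "decomp (Inl ` verts G) ((`) Inl ` edges G) (map (map_prod id (map Inl)) cs)"
    by (rule decomp_map[OF assms(1)]) simp
  moreover have "decomp (Inr ` verts H) ((`) Inr ` edges H) (map (map_prod id (map Inr)) ds)"
    by (rule decomp_map[OF assms(2)]) simp
  moreover have "(Inl ` verts G :: ('a + 'b) set) \<inter> Inr ` verts H = {}" by blast
  moreover have "verts (disjoint_union G H) = Inl ` verts G \<union> Inr ` verts H"
    "edges (disjoint_union G H) = (`) Inl ` edges G \<union> (`) Inr ` edges H"
    unfolding disjoint_union_def Plus_def by simp_all
  ultimately show ?thesis using decomp_append by metis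
qed

lemma sum_number_eqI:
  assumes "sum_graph (disjoint_union G (edgeless_graph n))"
    and "\<And>k. sum_graph (disjoint_union G (edgeless_graph k)) \<Longrightarrow> n \<le> k"
  shows "sum_number G = n"
  unfolding sum_number_def using assms by (intro Least_equality)

theorem theorem1:
  fixes G :: "'a ugraph"
  assumes "simple_graph G"
    and "verts G \<noteq> {}"
    and "\<forall>v \<in> verts G. \<not> isolated G v"
    and "max_degree G \<le> 2"
  shows "sum_number G =
    (if graph_iso G (cycle_graph 4) \<or>
        graph_iso G (disjoint_union (cycle_graph 4) (path_graph 2))
     then min_degree G + 1
     else min_degree G)"
proof -
  have fin: "finite (verts G)" and E: "edges G \<subseteq> {{x, y} | x y. x \<in> verts G \<and> y \<in> verts G \<and> x \<noteq> y}"
    using assms(1) unfolding simple_graph_def by auto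
  have "edges G \<subseteq> Pow (verts G)" using E by blast
  then have finE: "finite (edges G)" using fin by (meson finite_Pow_iff finite_subset)
  have nbr: "\<forall>v \<in> verts G. \<exists>e \<in> edges G. v \<in> e"
    using assms(3) unfolding isolated_def by blast
  have deg_ge: "1 \<le> degree G v" if "v \<in> verts G" for v
  proof -
    have "{e \<in> edges G. v \<in> e} \<noteq> {}" using nbr that by blast
    then show ?thesis unfolding degree_def using finE by (simp add: Suc_le_eq card_gt_0_iff)
  qed
  have deg_le: "degree G v \<le> 2" if "v \<in> verts G" for v
  proof -
    have "degree G v \<le> max_degree G" unfolding max_degree_def using fin that by simp
    then show ?thesis using assms(4) by simp
  qed
  have min_le: "min_degree G \<le> degree G v" if "v \<in> verts G" for v
    unfolding min_degree_def using fin that by simp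
  have min1: "1 \<le> min_degree G" unfolding min_degree_def using fin assms(2) deg_ge by simp
  have min2: "min_degree G \<le> 2" using min_le deg_le assms(2) by (meson all_not_in_conv le_trans)
  have lower: "min_degree G \<le> k" if "sum_graph (disjoint_union G (edgeless_graph k))" for k
    using min_degree_le_isolated[OF assms(1,2) that] .
  let ?C = "cycle_graph 4" let ?CP = "disjoint_union (cycle_graph 4) (path_graph 2)"
  have CP: "decomp (verts ?CP) (edges ?CP) [(True, [Inl 0, Inl 1, Inl 2, Inl 3]), (False, [Inr 0, Inr 1])]"
    using decomp_disjoint_union[OF decomp_C4 decomp_P2] by simp
  consider "graph_iso G ?C" | "graph_iso G ?CP" | "\<not> graph_iso G ?C" "\<not> graph_iso G ?CP" by blast
  then show ?thesis
  proof cases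
    case 1
    obtain cs where cs: "decomp (verts G) (edges G) cs"
      and "map shape cs = map shape [(True, [0, 1, 2, 3 :: nat])]"
      by (rule graph_iso_decomp[OF 1 assms(1) decomp_C4])
    then have sh: "map shape cs = [(True, 4)]" by (simp add: shape_def)
    then have M: "mset (map shape cs) = {#(True, 4)#}" by simp
    have "\<forall>c \<in> set cs. fst c" using sh by (auto simp: shape_def)
    then have d: "min_degree G = 2" using min_degree_cycles[OF cs assms(2)] min2 by simp
    have "sum_number G = 3"
    proof (rule sum_number_eqI)
      show "sum_graph (disjoint_union G (edgeless_graph 3))"
        unfolding sum_graph_iff[OF cs] M by (rule ex_sum_rep_C4)
      fix k assume k: "sum_graph (disjoint_union G (edgeless_graph k))"
      then have "k \<noteq> 2" unfolding sum_graph_iff[OF cs] M using not_sum_rep_C4_two by blast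
      then show "3 \<le> k" using lower[OF k] d by simp
    qed
    then show ?thesis using 1 d by simp
  next
    case 2
    obtain cs where cs: "decomp (verts G) (edges G) cs"
      and "map shape cs = map shape [(True, [Inl 0, Inl 1, Inl 2, Inl 3 :: nat + nat]), (False, [Inr 0, Inr 1])]"
      by (rule graph_iso_decomp[OF 2 assms(1) CP])
    then have sh: "map shape cs = [(True, 4), (False, 2)]" by (simp add: shape_def)
    then have M: "mset (map shape cs) = {#(True, 4), (False, 2)#}" by simp
    obtain ws p q where csd: "cs = [(True, ws), (False, [p, q])]" "length ws = 4"
      using sh by (auto simp: shape_def length_2_conv)
    have "p \<in> verts G" "p \<notin> set ws" and EG: "edges G = comp_edges (True, ws) \<union> {{p, q}}"
      using cs unfolding decomp_def csd by auto
    moreover have "e \<subseteq> set ws" if "e \<in> comp_edges (True, ws)" for e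
      using comp_edges_subset[OF _ that] csd(2) by simp
    \<comment> \<open>The end \<open>p\<close> of the added edge has degree one, so the minimum
      degree is 1.\<close>
    ultimately have "{e \<in> edges G. p \<in> e} \<subseteq> {{p, q}}" unfolding EG by blast
    then have "degree G p \<le> card {{p, q}}" unfolding degree_def by (intro card_mono) auto
    then have d: "min_degree G = 1" using min_le[OF \<open>p \<in> verts G\<close>] min1 by simp
    have "sum_number G = 2"
    proof (rule sum_number_eqI)
      show "sum_graph (disjoint_union G (edgeless_graph 2))"
        unfolding sum_graph_iff[OF cs] M by (rule ex_sum_rep_C4_P2)
      fix k assume k: "sum_graph (disjoint_union G (edgeless_graph k))"
      then have "k \<noteq> 1" unfolding sum_graph_iff[OF cs] M using not_sum_rep_C4_P2_one by blast
      then show "2 \<le> k" using lower[OF k] d by simp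
    qed
    then show ?thesis using 2 d by simp
  next
    case 3
    have "\<forall>v \<in> verts G. card {e \<in> edges G. v \<in> e} \<le> 2" using deg_le unfolding degree_def by blast
    then obtain cs where cs: "decomp (verts G) (edges G) cs"
      using ex_decomp[OF fin E nbr] by blast
    let ?M = "mset (map shape cs)"
    let ?k = "if \<exists>c \<in># ?M. \<not> fst c then 1 else 2 :: nat"
    have "?M \<noteq> {#(True, 4)#}"
      using decomp_graph_iso[OF cs decomp_C4] 3(1) by (auto simp: shape_def eval_nat_numeral)
    moreover have "?M \<noteq> {#(True, 4), (False, 2)#}"
      using decomp_graph_iso[OF cs CP] 3(2) by (auto simp: shape_def eval_nat_numeral)
    moreover have "?M \<noteq> {#}" using cs assms(2) unfolding decomp_def by auto
    moreover have "\<forall>c \<in># ?M. (if fst c then 3 else 2) \<le> snd c"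
      using cs unfolding decomp_def by (auto simp: shape_def split: if_splits)
    ultimately have "\<exists>S Z. sum_rep ?M S Z \<and> card Z = ?k" by (intro ex_sum_rep)
    then have sg: "sum_graph (disjoint_union G (edgeless_graph ?k))"
      unfolding sum_graph_iff[OF cs] .
    have "?k \<le> min_degree G"
    proof (cases "\<exists>c \<in># ?M. \<not> fst c")
      case True
      then show ?thesis using min1 by simp
    next
      case False
      then have "\<forall>c \<in> set cs. fst c" by (auto simp: shape_def)
      then show ?thesis using min_degree_cycles[OF cs assms(2)] by simp
    qed
    \<comment> \<open>The lower bound applied to the labelling just constructed gives the reverse
      inequality.\<close>
    then have "?k = min_degree G" using lower[OF sg] by simp
    then have "sum_number G = min_degree G" using sg lower by (intro sum_number_eqI) simp_all
    then show ?thesis using 3 by simp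
  qed
qed

end
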